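(* Let $T\in\mathbb{N}^*$, $\rho>0$, $\alpha\in\mathbb{R}$. For $N\in\mathbb{N}^*$ let $W_N$ be a symmetric $N\times N$ random matrix whose entries on and above the diagonal are i.i.d. $\mathcal{N}(0,\rho^2/N^{2\alpha})$, and let $B_{T,N}$ be its generalised matrix of moments of order $T$, with eigenvalues $\lambda_T(B_{T,N})\le\cdots\le\lambda_0(B_{T,N})$ ($\lambda_{\min}=\lambda_T$, $\lambda_{\max}=\lambda_0$). (1) If $\alpha=1/2$, then $\lambda_{\max}(B_{T,N})/N\to\lambda_{\max}(A_{\mathrm{sc}}(\rho,T))$ and $\lambda_{\min}(B_{T,N})/N\to\lambda_{\min}(A_{\mathrm{sc}}(\rho,T))$ as $N\to\infty$, and \[\lim_{N\to\infty}\frac{\lambda_{\max}(B_{T,N})}{\sum_{i=0}^T\lambda_i(B_{T,N})}=\frac{\lambda_{\max}(A_{\mathrm{sc}}(\rho,T))}{\mathrm{tr}(A_{\mathrm{sc}}(\rho,T))},\] where $A_{\mathrm{sc}}(\rho,T)=((A_{\mathrm{sc}}(\rho,T))_{l_1,l_2})_{0\le l_1,l_2\le T}$ has entries $0$ if $l_1+l_2$ is odd and $\frac{\rho^{l_1+l_2}}{\frac{l_1+l_2}2+1}\binom{l_1+l_2}{(l_1+l_2)/2}$ otherwise. (2) If $\alpha<1/2$, then $\lambda_{\max}(B_{T,N})\simeq\frac{\rho^{2T}}{T+1}\binom{2T}{T}N^{1+2T(\frac12-\alpha)}$ as $N\to\infty$, and $\lambda_{\max}(B_{T,N})/\sum_{i=0}^T\lambda_i(B_{T,N})\to1$.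 (3) If $\alpha>1/2$, then $\lambda_{\max}(B_{T,N})\simeq N$ as $N\to\infty$, and $\lambda_{\max}(B_{T,N})/\sum_{i=0}^T\lambda_i(B_{T,N})\to1$.
   Context: Generalised matrix of moments: for $i\in[N]$, $\beta_{i,0}=1$, $\beta_{i,l}=\sum_{i_1,\ldots,i_l=1}^N W_{ii_1}\cdots W_{i_{l-1}i_l}$ for $l\ge1$, and $B_{T,N}(l_1,l_2)=\mathbb{E}\sum_{i=1}^N\beta_{i,l_1}\beta_{i,l_2}$. $x_N\simeq y_N$ means $x_N/y_N\to1$. *)

theory Defs
  imports "HOL-Probability.Probability" "Jordan_Normal_Form.Char_Poly"
begin

text \<open>Indices are 0-based: [N] is rendered as {..<N}, and rows/columns 0..T.\<close>

definition upper_idx :: "nat \<Rightarrow> (nat \<times> nat) set" where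
  "upper_idx N = {(i, j). i \<le> j \<and> j < N}"

text \<open>Law of the independent entries on and above the diagonal, each N(0, rho^2/N^(2 alpha)),
  i.e. standard deviation rho / N^alpha.\<close>
definition wigner_measure :: "real \<Rightarrow> real \<Rightarrow> nat \<Rightarrow> ((nat \<times> nat) \<Rightarrow> real) measure" where
  "wigner_measure \<rho> \<alpha> N =
     PiM (upper_idx N) (\<lambda>_. density lborel (normal_density 0 (\<rho> / real N powr \<alpha>)))"

definition sym_entry :: "((nat \<times> nat) \<Rightarrow> real) \<Rightarrow> nat \<Rightarrow> nat \<Rightarrow> real" where
  "sym_entry \<omega> i j = \<omega> (min i j, max i j)"

text \<open>beta_{i,l} = sum over i_1..i_l of W_{i i_1} ... W_{i_{l-1} i_l}; the path p has p 0 = i.\<close>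
definition gm_beta :: "nat \<Rightarrow> (nat \<Rightarrow> nat \<Rightarrow> real) \<Rightarrow> nat \<Rightarrow> nat \<Rightarrow> real" where
  "gm_beta N W i l =
     (\<Sum>p \<in> {p \<in> {..l} \<rightarrow>\<^sub>E {..<N}. p 0 = i}. \<Prod>k<l. W (p k) (p (Suc k)))"

definition gen_moment_matrix :: "real \<Rightarrow> real \<Rightarrow> nat \<Rightarrow> nat \<Rightarrow> real mat" where
  "gen_moment_matrix \<rho> \<alpha> T N = mat (T + 1) (T + 1) (\<lambda>(l1, l2).
     \<integral>\<omega>. (\<Sum>i<N. gm_beta N (sym_entry \<omega>) i l1 * gm_beta N (sym_entry \<omega>) i l2)
       \<partial>(wigner_measure \<rho> \<alpha> N))"

definition A_sc :: "real \<Rightarrow> nat \<Rightarrow> real mat" where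
  "A_sc \<rho> T = mat (T + 1) (T + 1) (\<lambda>(l1, l2).
     if odd (l1 + l2) then 0
     else \<rho> ^ (l1 + l2) / (real ((l1 + l2) div 2) + 1) * real ((l1 + l2) choose ((l1 + l2) div 2)))"

definition eigvals :: "real mat \<Rightarrow> real multiset" where
  "eigvals A = proots (char_poly A)"

definition lambda_max :: "real mat \<Rightarrow> real" where
  "lambda_max A = Max (set_mset (eigvals A))"

definition lambda_min :: "real mat \<Rightarrow> real" where
  "lambda_min A = Min (set_mset (eigvals A))"

definition eig_sum :: "real mat \<Rightarrow> real" where
  "eig_sum A = sum_mset (eigvals A)"

definition mat_trace :: "real mat \<Rightarrow> real" where
  "mat_trace A = (\<Sum>i<dim_row A. A $$ (i, i))"

end

theory Submission
  imports Defs "Jordan_Normal_Form.Schur_Decomposition"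
begin

text \<open>The entry \<open>(l1, l2)\<close> of the moment matrix is the expected sum of all entries of \<open>W^(l1 + l2)\<close>.
  Gaussian integration by parts in the first factor of \<open>W^(L + 1)\<close> pairs it with one of the other
  factors. Pairing with the \<open>k\<close>-th one in reversed orientation splits the walk into a closed walk of
  length \<open>k\<close> and a walk of length \<open>L - 1 - k\<close>; all other pairings lose at least a factor \<open>N\<close>.
  Stated for expectations of one such sum times a product of traces of powers, the recursion is
  closed: the lower-order terms are nonnegative and dominated by expectations of the same kind.
  Hence these expectations factorise in the limit, with factors satisfying the Catalan recursion.

  So the moment matrix, divided by \<open>N\<close> or by the claimed leading term, converges entrywise to
  \<open>A_sc\<close> or to a matrix with a single diagonal entry 1. By the variational characterisation,
  extreme eigenvalues of symmetric matrices are Lipschitz in the entries, and the sum of the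
  eigenvalues is the trace.\<close>

section \<open>Extreme eigenvalues of real symmetric matrices\<close>

text \<open>The equal variance on and off the diagonal shapes the recursion. An orthogonally
  invariant law, with doubled variance on the diagonal, would give exact equations between traces;
  here differentiation by a diagonal entry yields one matrix unit instead of two, and terms
  restricted to i = j arise that are not products of traces. They are never evaluated. Adding them
  completes each lower-order term to a sum over full walks, and nonnegativity of all coefficients
  places the remainder between 0 and these completed sums. The same induction carries the whole list
  of traces, so that factorisation in the limit comes out without a separate variance estimate. The
  normalisation absorbs \<sigma>: one limit holds for every positive sequence of standard
  deviations, and the three regimes of \<alpha> only compare powers of N afterwards.\<close>

definition quad_form :: "nat \<Rightarrow> (nat \<Rightarrow> nat \<Rightarrow> real) \<Rightarrow> (nat \<Rightarrow> real) \<Rightarrow> real" where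
  "quad_form n a x = (\<Sum>i<n. \<Sum>j<n. a i j * x i * x j)"

text \<open>Vectors are functions on the naturals extended by zero, because the dimension is a
  variable and not a type; compactness then comes from Tychonoff for a product of intervals and
  singletons.\<close>

lemma compact_unit_sphere_fun:
  "compact {x :: nat \<Rightarrow> real. (\<forall>i\<ge>n. x i = 0) \<and> (\<Sum>i<n. (x i)\<^sup>2) = 1}" (is "compact ?S")
proof -
  let ?C = "\<lambda>i. if i < n then {-1..1} else {0::real}"
  have "compactin (product_topology (\<lambda>i::nat. euclidean) UNIV) (PiE UNIV ?C)"
    by (subst compactin_PiE) auto
  then have c: "compact (PiE UNIV ?C)"
    by (simp add: euclidean_product_topology)
  have "closed ({x :: nat \<Rightarrow> real. (\<Sum>i<n. (x i)\<^sup>2) = 1})"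
    by (intro closed_Collect_eq continuous_intros continuous_on_product_coordinates)
  with c have "compact (PiE UNIV ?C \<inter> {x :: nat \<Rightarrow> real. (\<Sum>i<n. (x i)\<^sup>2) = 1})"
    by (rule compact_Int_closed)
  moreover have "PiE UNIV ?C \<inter> {x. (\<Sum>i<n. (x i)\<^sup>2) = 1} = ?S"
  proof -
    have "x i \<in> {-1..1}" if "(\<Sum>i<n. (x i)\<^sup>2) = 1" "i < n" for x :: "nat \<Rightarrow> real" and i
    proof -
      have "(x i)\<^sup>2 \<le> (\<Sum>i<n. (x i)\<^sup>2)"
        using that by (intro member_le_sum) auto
      with that have "\<bar>x i\<bar> \<le> 1" by (simp add: abs_square_le_1)
      then show ?thesis by auto
    qed
    moreover have "PiE UNIV ?C = {x. (\<forall>i<n. x i \<in> {-1..1}) \<and> (\<forall>i\<ge>n. x i = 0)}"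
      by (auto simp: PiE_UNIV_domain Pi_def linorder_not_less split: if_splits)
    ultimately show ?thesis by blast
  qed
  ultimately show ?thesis by simp
qed

lemma quad_form_scale: "quad_form n a (\<lambda>i. c * x i) = c\<^sup>2 * quad_form n a x"
  unfolding quad_form_def sum_distrib_left by (intro sum.cong) (auto simp: power2_eq_square)

text \<open>\<open>\<mu>\<close> is the maximum of the form on the unit sphere and \<open>x\<close> a maximiser: the nonnegative form
  \<open>\<mu> |y|\<^sup>2 - quad_form n a y\<close> vanishes at \<open>x\<close>, hence so does its gradient.\<close>
lemma rayleigh_attained:
  assumes "n > 0" and sym: "\<And>i j. i < n \<Longrightarrow> j < n \<Longrightarrow> a i j = a j i"
  obtains \<mu> x where "\<exists>i<n. x i \<noteq> 0" "\<And>i. i < n \<Longrightarrow> (\<Sum>j<n. a i j * x j) = \<mu> * x i"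
    "\<And>y. quad_form n a y \<le> \<mu> * (\<Sum>i<n. (y i)\<^sup>2)"
proof -
  let ?S = "{x :: nat \<Rightarrow> real. (\<forall>i\<ge>n. x i = 0) \<and> (\<Sum>i<n. (x i)\<^sup>2) = 1}"
  define u :: "nat \<Rightarrow> real" where "u i = (if i = 0 then 1 else 0)" for i
  have "(\<Sum>i<n. (u i)\<^sup>2) = (\<Sum>i<n. if i = 0 then 1 else 0)"
    by (intro sum.cong) (auto simp: u_def)
  also have "\<dots> = 1" using \<open>n > 0\<close> by (subst sum.delta) auto
  finally have "u \<in> ?S"
    using \<open>n > 0\<close> by (intro CollectI conjI allI impI) (auto simp: u_def)
  then have "?S \<noteq> {}" by blast
  moreover have "continuous_on UNIV (quad_form n a)"
    unfolding quad_form_def by (intro continuous_intros continuous_on_product_coordinates)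
  then have "continuous_on ?S (quad_form n a)" by (rule continuous_on_subset) simp
  ultimately obtain x where x: "x \<in> ?S" and max: "\<And>y. y \<in> ?S \<Longrightarrow> quad_form n a y \<le> quad_form n a x"
    using continuous_attains_sup[OF compact_unit_sphere_fun, of n "quad_form n a"] by blast
  define \<mu> where "\<mu> = quad_form n a x"
  have bound: "quad_form n a y \<le> \<mu> * (\<Sum>i<n. (y i)\<^sup>2)" for y
  proof (cases "(\<Sum>i<n. (y i)\<^sup>2) = 0")
    case True
    then have "\<And>i. i < n \<Longrightarrow> y i = 0" by (simp add: sum_nonneg_eq_0_iff)
    then have "quad_form n a y = 0" by (simp add: quad_form_def)
    with True show ?thesis by simp
  next
    case False
    define s where "s = (\<Sum>i<n. (y i)\<^sup>2)"
    have s: "s > 0" using False unfolding s_def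
      by (metis less_eq_real_def sum_nonneg zero_le_power2)
    define z where "z i = (if i < n then 1 / sqrt s * y i else 0)" for i
    have "(\<Sum>i<n. (z i)\<^sup>2) = (\<Sum>i<n. 1 / s * (y i)\<^sup>2)"
      using s by (intro sum.cong) (auto simp: z_def power_mult_distrib power_divide)
    also have "\<dots> = 1 / s * s" unfolding s_def sum_distrib_left ..
    also have "\<dots> = 1" using s by simp
    finally have "z \<in> ?S" by (auto simp: z_def)
    then have "quad_form n a z \<le> \<mu>" using max by (simp add: \<mu>_def)
    moreover have "quad_form n a z = quad_form n a (\<lambda>i. 1 / sqrt s * y i)"
      unfolding quad_form_def by (intro sum.cong) (auto simp: z_def)
    then have "quad_form n a z = quad_form n a y / s"
      using s by (simp only: quad_form_scale) (simp add: power_divide)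
    ultimately show ?thesis using s by (simp add: s_def[symmetric] field_simps)
  qed
  have ev: "(\<Sum>j<n. a i j * x j) = \<mu> * x i" if i: "i < n" for i
  proof -
    define b where "b = (\<Sum>j<n. a i j * x j) - \<mu> * x i"
    define r where "r = a i i - \<mu>"
    \<comment> \<open>Move the maximiser by t along the i-th coordinate: the form minus \<mu> times
      the squared norm is 0 at x and stays nonpositive, and the left-hand side is its exact
      expansion in t.\<close>
    have t: "2 * t * b + t\<^sup>2 * r \<le> 0" for t
    proof -
      let ?e = "\<lambda>k. if k = i then t else 0"
      have "quad_form n a (\<lambda>k. x k + ?e k) =
         quad_form n a x + (\<Sum>k<n. \<Sum>j<n. a k j * x k * ?e j) + (\<Sum>k<n. \<Sum>j<n. a k j * ?e k * x j)
          + (\<Sum>k<n. \<Sum>j<n. a k j * ?e k * ?e j)"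
        unfolding quad_form_def by (simp add: algebra_simps sum.distrib)
      also have "(\<Sum>k<n. \<Sum>j<n. a k j * x k * ?e j) = t * (\<Sum>j<n. a i j * x j)"
        using i sym[OF _ i] by (simp add: if_distrib sum_distrib_left mult_ac cong: if_cong)
      also have "(\<Sum>k<n. \<Sum>j<n. a k j * ?e k * x j) = (\<Sum>k<n. if k = i then \<Sum>j<n. a k j * t * x j else 0)"
        by (intro sum.cong) auto
      also have "\<dots> = t * (\<Sum>j<n. a i j * x j)"
        using i by (simp add: sum_distrib_left mult_ac)
      also have "(\<Sum>k<n. \<Sum>j<n. a k j * ?e k * ?e j) = (\<Sum>k<n. if k = i then a i i * t\<^sup>2 else 0)"
        using i by (intro sum.cong) (auto simp: if_distrib power2_eq_square cong: if_cong)
      also have "\<dots> = a i i * t\<^sup>2" using i by simp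
      finally have 1: "quad_form n a (\<lambda>k. x k + ?e k) = \<mu> + 2 * t * (\<Sum>j<n. a i j * x j) + a i i * t\<^sup>2"
        by (simp add: \<mu>_def)
      have "(\<Sum>k<n. (x k + ?e k)\<^sup>2) = (\<Sum>k<n. (x k)\<^sup>2) + (\<Sum>k<n. if k = i then 2 * x k * t + t\<^sup>2 else 0)"
        by (subst sum.distrib[symmetric]) (intro sum.cong, auto simp: power2_sum)
      also have "\<dots> = 1 + 2 * x i * t + t\<^sup>2" using x i by simp
      finally have "\<mu> + 2 * t * (\<Sum>j<n. a i j * x j) + a i i * t\<^sup>2 \<le> \<mu> * (1 + 2 * x i * t + t\<^sup>2)"
        using bound[of "\<lambda>k. x k + ?e k"] 1 by simp
      then show ?thesis by (simp add: b_def r_def algebra_simps)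
    qed
    have "b = 0"
    proof (rule ccontr)
      assume "b \<noteq> 0"
      \<comment> \<open>\<open>m\<close> is a positive bound for |r|; at t = b / m the linear term 2
        b^2 / m outweighs the quadratic one, which is at least - b^2 / m.\<close>
      define m where "m = \<bar>r\<bar> + 1"
      have m: "m > 0" "r \<ge> - m" by (auto simp: m_def)
      have "2 * (b / m) * b + (b / m)\<^sup>2 * (-m) \<le> 2 * (b / m) * b + (b / m)\<^sup>2 * r"
        using m by (intro add_left_mono mult_left_mono) auto
      also have "\<dots> \<le> 0" by (rule t)
      also have "2 * (b / m) * b + (b / m)\<^sup>2 * (-m) = b\<^sup>2 / m"
        using m by (simp add: power2_eq_square field_simps)
      finally show False using m \<open>b \<noteq> 0\<close> by (simp add: divide_le_0_iff)
    qed
    then show ?thesis by (simp add: b_def)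
  qed
  have "\<exists>i<n. x i \<noteq> 0"
  proof (rule ccontr)
    assume "\<not> ?thesis"
    then have "(\<Sum>i<n. (x i)\<^sup>2) = 0" by simp
    with x show False by simp
  qed
  then show ?thesis using that ev bound by blast
qed

section \<open>Eigenvalue multisets and extreme eigenvalues\<close>

lemma set_eigvals:
  assumes "A \<in> carrier_mat n n"
  shows "set_mset (eigvals A) = {k. eigenvalue A k}"
proof -
  have "char_poly A \<noteq> 0"
    using degree_monic_char_poly[OF assms] by auto
  then show ?thesis
    by (simp add: eigvals_def eigenvalue_root_char_poly[OF assms])
qed

lemma eigenvalue_iff_fun:
  fixes A :: "real mat"
  assumes A: "A \<in> carrier_mat n n"
  shows "eigenvalue A k \<longleftrightarrow> (\<exists>x. (\<exists>i<n. x i \<noteq> 0) \<and> (\<forall>i<n. (\<Sum>j<n. A $$ (i, j) * x j) = k * x i))"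
proof
  assume "eigenvalue A k"
  then obtain v where v: "v \<in> carrier_vec n" "v \<noteq> 0\<^sub>v n" "A *\<^sub>v v = k \<cdot>\<^sub>v v"
    using A by (auto simp: eigenvalue_def eigenvector_def)
  have "\<exists>i<n. v $ i \<noteq> 0"
    using v(1,2) by (metis carrier_vecD eq_vecI index_zero_vec)
  moreover have "(\<Sum>j<n. A $$ (i, j) * v $ j) = k * v $ i" if "i < n" for i
  proof -
    have "(A *\<^sub>v v) $ i = (k \<cdot>\<^sub>v v) $ i" using v by simp
    then show ?thesis using that A v(1)
      by (simp add: scalar_prod_def row_def atLeast0LessThan)
  qed
  ultimately show "\<exists>x. (\<exists>i<n. x i \<noteq> 0) \<and> (\<forall>i<n. (\<Sum>j<n. A $$ (i, j) * x j) = k * x i)"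
    by blast
next
  assume "\<exists>x. (\<exists>i<n. x i \<noteq> 0) \<and> (\<forall>i<n. (\<Sum>j<n. A $$ (i, j) * x j) = k * x i)"
  then obtain x where x: "\<exists>i<n. x i \<noteq> 0" "\<forall>i<n. (\<Sum>j<n. A $$ (i, j) * x j) = k * x i" by blast
  have "eigenvector A (vec n x) k"
    unfolding eigenvector_def
  proof (intro conjI)
    show "vec n x \<in> carrier_vec (dim_row A)" using A by auto
    show "vec n x \<noteq> 0\<^sub>v (dim_row A)" using x(1) A by (metis carrier_matD(1) index_vec index_zero_vec(1))
    show "A *\<^sub>v vec n x = k \<cdot>\<^sub>v vec n x"
      using A x(2) by (intro eq_vecI) (auto simp: scalar_prod_def row_def atLeast0LessThan)
  qed
  then show "eigenvalue A k" by (auto simp: eigenvalue_def)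
qed

text \<open>Any eigenvalue is the Rayleigh quotient of its eigenvector and hence at most the maximum
  \<mu>, which is itself an eigenvalue. So real eigenvalues exist, and \<open>Max\<close> over the
  real roots of the characteristic polynomial is meaningful.\<close>

lemma lambda_max_rayleigh:
  assumes A: "A \<in> carrier_mat n n" and n: "n > 0" and sym: "transpose_mat A = A"
  shows "eigenvalue A (lambda_max A)"
    and "quad_form n (\<lambda>i j. A $$ (i, j)) y \<le> lambda_max A * (\<Sum>i<n. (y i)\<^sup>2)"
proof -
  let ?a = "\<lambda>i j. A $$ (i, j)"
  have a: "?a i j = ?a j i" if "i < n" "j < n" for i j
    using that A sym by (metis carrier_matD index_transpose_mat(1))
  obtain \<mu> x where x: "\<exists>i<n. x i \<noteq> 0" "\<And>i. i < n \<Longrightarrow> (\<Sum>j<n. ?a i j * x j) = \<mu> * x i"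
    and b: "\<And>y. quad_form n ?a y \<le> \<mu> * (\<Sum>i<n. (y i)\<^sup>2)"
    by (rule rayleigh_attained[OF n, of ?a]) (use a in blast)+
  have ev: "eigenvalue A \<mu>" using x eigenvalue_iff_fun[OF A] by blast
  have "k \<le> \<mu>" if "eigenvalue A k" for k
  proof -
    from that obtain z where z: "\<exists>i<n. z i \<noteq> 0" "\<forall>i<n. (\<Sum>j<n. ?a i j * z j) = k * z i"
      using eigenvalue_iff_fun[OF A] by blast
    have "quad_form n ?a z = (\<Sum>i<n. z i * (\<Sum>j<n. ?a i j * z j))"
      by (simp add: quad_form_def sum_distrib_left mult_ac)
    also have "\<dots> = k * (\<Sum>i<n. (z i)\<^sup>2)"
      using z(2) by (simp add: sum_distrib_left power2_eq_square mult_ac)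
    finally have "k * (\<Sum>i<n. (z i)\<^sup>2) \<le> \<mu> * (\<Sum>i<n. (z i)\<^sup>2)" using b[of z] by simp
    moreover have "(\<Sum>i<n. (z i)\<^sup>2) > 0"
      using z(1) by (metis finite_lessThan lessThan_iff sum_pos2 zero_le_power2 zero_less_power2)
    ultimately show ?thesis by simp
  qed
  then have "lambda_max A = \<mu>"
    unfolding lambda_max_def using ev set_eigvals[OF A] by (intro Max_eqI finite_set_mset) auto
  with ev b show "eigenvalue A (lambda_max A)"
    "quad_form n ?a y \<le> lambda_max A * (\<Sum>i<n. (y i)\<^sup>2)" by auto
qed

text \<open>An eigenvector of \<open>A\<close> for its top eigenvalue serves as test vector for
  \<open>B\<close>; the perturbation costs at most the sum of the absolute entries, since |x i * x
  j| is at most the squared norm.\<close>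

lemma lambda_max_le_add:
  assumes A: "A \<in> carrier_mat n n" "transpose_mat A = A"
    and B: "B \<in> carrier_mat n n" "transpose_mat B = B" and n: "n > 0"
  shows "lambda_max A \<le> lambda_max B + (\<Sum>i<n. \<Sum>j<n. \<bar>A $$ (i, j) - B $$ (i, j)\<bar>)"
proof -
  let ?a = "\<lambda>i j. A $$ (i, j)" and ?b = "\<lambda>i j. B $$ (i, j)"
  obtain x where x: "\<exists>i<n. x i \<noteq> 0" "\<forall>i<n. (\<Sum>j<n. ?a i j * x j) = lambda_max A * x i"
    using lambda_max_rayleigh(1)[OF A(1) n A(2)] eigenvalue_iff_fun[OF A(1)] by blast
  define s where "s = (\<Sum>i<n. (x i)\<^sup>2)"
  have s: "s > 0"
    using x(1) unfolding s_def by (metis finite_lessThan lessThan_iff sum_pos2 zero_le_power2 zero_less_power2)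
  have x2: "(x i)\<^sup>2 \<le> s" if "i < n" for i
    unfolding s_def using that by (intro member_le_sum) auto
  have xx: "\<bar>x i * x j\<bar> \<le> s" if "i < n" "j < n" for i j
  proof -
    have "2 * \<bar>x i * x j\<bar> \<le> (x i)\<^sup>2 + (x j)\<^sup>2"
      using sum_squares_bound[of "\<bar>x i\<bar>" "\<bar>x j\<bar>"] by (simp add: abs_mult)
    with x2[OF that(1)] x2[OF that(2)] show ?thesis by linarith
  qed
  have "quad_form n ?a x = (\<Sum>i<n. x i * (\<Sum>j<n. ?a i j * x j))"
    by (simp add: quad_form_def sum_distrib_left mult_ac)
  also have "\<dots> = lambda_max A * s"
    using x(2) by (simp add: s_def sum_distrib_left power2_eq_square mult_ac)
  finally have "lambda_max A * s = quad_form n ?b x + (\<Sum>i<n. \<Sum>j<n. (?a i j - ?b i j) * (x i * x j))"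
    by (simp add: quad_form_def left_diff_distrib sum_subtractf mult.assoc)
  also have "\<dots> \<le> lambda_max B * s + (\<Sum>i<n. \<Sum>j<n. \<bar>?a i j - ?b i j\<bar> * s)"
  proof (intro add_mono sum_mono)
    show "quad_form n ?b x \<le> lambda_max B * s"
      using lambda_max_rayleigh(2)[OF B(1) n B(2)] by (simp add: s_def)
    fix i j assume "i \<in> {..<n}" "j \<in> {..<n}"
    then have "\<bar>?a i j - ?b i j\<bar> * \<bar>x i * x j\<bar> \<le> \<bar>?a i j - ?b i j\<bar> * s"
      using xx[of i j] by (intro mult_left_mono) auto
    then show "(?a i j - ?b i j) * (x i * x j) \<le> \<bar>?a i j - ?b i j\<bar> * s"
      using abs_ge_self[of "(?a i j - ?b i j) * (x i * x j)"] unfolding abs_mult[of "?a i j - ?b i j"]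
      by linarith
  qed
  also have "\<dots> = (lambda_max B + (\<Sum>i<n. \<Sum>j<n. \<bar>?a i j - ?b i j\<bar>)) * s"
    by (simp add: sum_distrib_right distrib_right)
  finally show ?thesis using s by simp
qed

lemma tendsto_lambda_max:
  assumes "n > 0" and F: "\<And>N. F N \<in> carrier_mat n n" "\<And>N. transpose_mat (F N) = F N"
    and A: "A \<in> carrier_mat n n" "transpose_mat A = A"
    and lim: "\<And>i j. i < n \<Longrightarrow> j < n \<Longrightarrow> (\<lambda>N. F N $$ (i, j)) \<longlonglongrightarrow> A $$ (i, j)"
  shows "(\<lambda>N. lambda_max (F N)) \<longlonglongrightarrow> lambda_max A"
proof -
  let ?d = "\<lambda>N. \<Sum>i<n. \<Sum>j<n. \<bar>F N $$ (i, j) - A $$ (i, j)\<bar>"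
  have "?d \<longlonglongrightarrow> (\<Sum>i<n. \<Sum>j<n. \<bar>A $$ (i, j) - A $$ (i, j)\<bar>)"
    using lim by (intro tendsto_intros) auto
  then have d: "?d \<longlonglongrightarrow> 0" by simp
  have "\<bar>lambda_max (F N) - lambda_max A\<bar> \<le> ?d N" for N
    using lambda_max_le_add[OF F A assms(1), of N] lambda_max_le_add[OF A F assms(1), of N]
    by (simp add: abs_minus_commute)
  then have "(\<lambda>N. lambda_max (F N) - lambda_max A) \<longlonglongrightarrow> 0"
    by (intro Lim_null_comparison[OF _ d]) auto
  then show ?thesis by (simp add: LIM_zero_iff)
qed

lemma eigenvalue_smult_real:
  fixes A :: "real mat"
  assumes A: "A \<in> carrier_mat n n" and c: "c \<noteq> 0"
  shows "eigenvalue (c \<cdot>\<^sub>m A) (c * k) \<longleftrightarrow> eigenvalue A k"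
proof -
  have cA: "c \<cdot>\<^sub>m A \<in> carrier_mat n n" using A by simp
  have 1: "(\<Sum>j<n. (c \<cdot>\<^sub>m A) $$ (i, j) * x j) = c * (\<Sum>j<n. A $$ (i, j) * x j)" if "i < n" for i x
    using that A by (simp add: sum_distrib_left mult_ac)
  have 2: "c * y = c * k * z \<longleftrightarrow> y = k * z" for y z
    using mult_cancel_left[of c y "k * z"] c by (simp only: mult.assoc) blast
  have "(\<forall>i<n. (\<Sum>j<n. (c \<cdot>\<^sub>m A) $$ (i, j) * x j) = c * k * x i) \<longleftrightarrow>
      (\<forall>i<n. (\<Sum>j<n. A $$ (i, j) * x j) = k * x i)" for x
    using 1[of _ x] by (simp only: 2 cong: imp_cong)
  then show ?thesis
    by (simp only: eigenvalue_iff_fun[OF A] eigenvalue_iff_fun[OF cA])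
qed

lemma eigvals_smult_set:
  fixes A :: "real mat"
  assumes A: "A \<in> carrier_mat n n" and c: "c \<noteq> 0"
  shows "set_mset (eigvals (c \<cdot>\<^sub>m A)) = (\<lambda>k. c * k) ` set_mset (eigvals A)"
proof -
  have cA: "c \<cdot>\<^sub>m A \<in> carrier_mat n n" using A by simp
  have "k \<in> (\<lambda>k. c * k) ` {k. eigenvalue A k}" if "eigenvalue (c \<cdot>\<^sub>m A) k" for k
  proof -
    have "k = c * (k / c)" using c by simp
    with that show ?thesis using eigenvalue_smult_real[OF A c, of "k / c"]
      by (metis (mono_tags) imageI mem_Collect_eq)
  qed
  then show ?thesis
    by (auto simp: set_eigvals[OF A] set_eigvals[OF cA] eigenvalue_smult_real[OF A c])
qed

lemma set_eigvals_symmetric_nonempty: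
  assumes "A \<in> carrier_mat n n" "transpose_mat A = A" "n > 0"
  shows "set_mset (eigvals A) \<noteq> {}"
  using lambda_max_rayleigh(1)[OF assms(1,3,2)] set_eigvals[OF assms(1)] by auto

lemma lambda_max_smult:
  assumes "A \<in> carrier_mat n n" "transpose_mat A = A" "n > 0" "c > 0"
  shows "lambda_max (c \<cdot>\<^sub>m A) = c * lambda_max A"
proof -
  have "mono (\<lambda>k. c * k)" using assms by (simp add: mono_def)
  from mono_Max_commute[OF this, of "set_mset (eigvals A)"] show ?thesis
    using assms set_eigvals_symmetric_nonempty[OF assms(1-3)]
    by (simp add: lambda_max_def eigvals_smult_set[OF assms(1)])
qed

lemma lambda_min_eq_uminus_lambda_max:
  assumes "A \<in> carrier_mat n n" "transpose_mat A = A" "n > 0"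
  shows "lambda_min A = - lambda_max (- 1 \<cdot>\<^sub>m A)"
proof -
  have "set_mset (eigvals (- 1 \<cdot>\<^sub>m A)) = (\<lambda>k. - 1 * k) ` set_mset (eigvals A)"
    by (rule eigvals_smult_set[OF assms(1)]) simp
  also have "(\<lambda>k :: real. - 1 * k) = uminus" by auto
  finally have "set_mset (eigvals (- 1 \<cdot>\<^sub>m A)) = uminus ` set_mset (eigvals A)" .
  then show ?thesis
    unfolding lambda_max_def lambda_min_def
    using minus_Min_eq_Max[OF finite_set_mset set_eigvals_symmetric_nonempty[OF assms]]
    by (metis minus_minus)
qed

lemma lambda_min_smult:
  assumes "A \<in> carrier_mat n n" "transpose_mat A = A" "n > 0" "c > 0"
  shows "lambda_min (c \<cdot>\<^sub>m A) = c * lambda_min A"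
proof -
  have "mono (\<lambda>k. c * k)" using assms by (simp add: mono_def)
  from mono_Min_commute[OF this, of "set_mset (eigvals A)"] show ?thesis
    using assms set_eigvals_symmetric_nonempty[OF assms(1-3)]
    by (simp add: lambda_min_def eigvals_smult_set[OF assms(1)])
qed

lemma transpose_smult_mat: "transpose_mat (c \<cdot>\<^sub>m A) = c \<cdot>\<^sub>m transpose_mat A"
  by (rule eq_matI) auto

lemma tendsto_lambda_min:
  assumes n: "n > 0" and F: "\<And>N. F N \<in> carrier_mat n n" "\<And>N. transpose_mat (F N) = F N"
    and A: "A \<in> carrier_mat n n" "transpose_mat A = A"
    and lim: "\<And>i j. i < n \<Longrightarrow> j < n \<Longrightarrow> (\<lambda>N. F N $$ (i, j)) \<longlonglongrightarrow> A $$ (i, j)"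
  shows "(\<lambda>N. lambda_min (F N)) \<longlonglongrightarrow> lambda_min A"
proof -
  have "(\<lambda>N. lambda_max (- 1 \<cdot>\<^sub>m F N)) \<longlonglongrightarrow> lambda_max (- 1 \<cdot>\<^sub>m A)"
  proof (rule tendsto_lambda_max[OF n])
    fix i j assume ij: "i < n" "j < n"
    have "(\<lambda>N. - 1 * F N $$ (i, j)) \<longlonglongrightarrow> - 1 * A $$ (i, j)"
      by (intro tendsto_intros lim ij)
    moreover have "(- 1 \<cdot>\<^sub>m F N) $$ (i, j) = - 1 * F N $$ (i, j)" for N
      using F(1)[of N] ij by auto
    moreover have "(- 1 \<cdot>\<^sub>m A) $$ (i, j) = - 1 * A $$ (i, j)"
      using A ij by auto
    ultimately show "(\<lambda>N. (- 1 \<cdot>\<^sub>m F N) $$ (i, j)) \<longlonglongrightarrow> (- 1 \<cdot>\<^sub>m A) $$ (i, j)" by simp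
  qed (use F A in \<open>auto simp: transpose_smult_mat\<close>)
  from tendsto_minus[OF this] show ?thesis
    unfolding lambda_min_eq_uminus_lambda_max[OF F n] lambda_min_eq_uminus_lambda_max[OF A n] .
qed

section \<open>Real spectrum and trace formula\<close>

lemma symmetric_real_eigenvalue:
  fixes A :: "real mat"
  assumes A: "A \<in> carrier_mat n n" and sym: "transpose_mat A = A"
    and ev: "eigenvalue (map_mat complex_of_real A) k"
  shows "k \<in> \<real>"
proof -
  let ?a = "\<lambda>i j. complex_of_real (A $$ (i, j))"
  obtain v where v: "v \<in> carrier_vec n" "v \<noteq> 0\<^sub>v n" "map_mat complex_of_real A *\<^sub>v v = k \<cdot>\<^sub>v v"
    using A ev by (auto simp: eigenvalue_def eigenvector_def)
  have e: "(\<Sum>j<n. ?a i j * v $ j) = k * v $ i" if "i < n" for i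
  proof -
    have "(map_mat complex_of_real A *\<^sub>v v) $ i = (k \<cdot>\<^sub>v v) $ i" using v by simp
    then show ?thesis using that A v(1)
      by (simp add: scalar_prod_def row_def atLeast0LessThan)
  qed
  define s where "s = (\<Sum>i<n. (cmod (v $ i))\<^sup>2)"
  obtain i0 where "i0 < n" "v $ i0 \<noteq> 0"
    using v(1,2) by (metis carrier_vecD eq_vecI index_zero_vec)
  then have s: "s > 0" unfolding s_def by (intro sum_pos2[of _ i0]) auto
  \<comment> \<open>The Hermitian form at v: the eigenvalue equation evaluates it to k times the
    squared norm, while symmetry and realness of \<open>A\<close> make it equal to its
    conjugate.\<close>
  define q where "q = (\<Sum>i<n. \<Sum>j<n. ?a i j * (cnj (v $ i) * v $ j))"
  have "q = (\<Sum>i<n. cnj (v $ i) * (\<Sum>j<n. ?a i j * v $ j))"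
    by (simp add: q_def sum_distrib_left mult_ac)
  also have "\<dots> = (\<Sum>i<n. k * complex_of_real ((cmod (v $ i))\<^sup>2))"
    using e by (intro sum.cong) (simp_all only: lessThan_iff complex_norm_square mult_ac)
  finally have qk: "q = k * complex_of_real s" by (simp add: s_def sum_distrib_left)
  have "cnj q = (\<Sum>i<n. \<Sum>j<n. ?a i j * (v $ i * cnj (v $ j)))"
    by (simp add: q_def)
  also have "\<dots> = (\<Sum>j<n. \<Sum>i<n. ?a i j * (v $ i * cnj (v $ j)))" by (rule sum.swap)
  also have "\<dots> = q" unfolding q_def
  proof (intro sum.cong refl)
    fix i j assume "i \<in> {..<n}" "j \<in> {..<n}"
    then have "A $$ (j, i) = A $$ (i, j)"
      using A sym by (metis carrier_matD index_transpose_mat(1) lessThan_iff)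
    then show "?a j i * (v $ j * cnj (v $ i)) = ?a i j * (cnj (v $ i) * v $ j)" by simp
  qed
  finally have "q \<in> \<real>" by (simp add: Reals_cnj_iff)
  moreover have "k = q / complex_of_real s" using qk s by simp
  ultimately show ?thesis by (metis Reals_divide Reals_of_real)
qed

text \<open>\<open>eigvals\<close> collects real roots only, so the sum of eigenvalues could miss
  part of the spectrum. All complex roots being real, the complex factorisation is the image of a
  real one, and the embedding of the coefficients is injective.\<close>

lemma symmetric_char_poly_splits:
  fixes A :: "real mat"
  assumes A: "A \<in> carrier_mat n n" and sym: "transpose_mat A = A"
  obtains es where "char_poly A = (\<Prod>e\<leftarrow>es. [:- e, 1:])"
proof -
  interpret map_poly_of_real: map_poly_inj_comm_ring_hom complex_of_real ..
  let ?A = "map_mat complex_of_real A"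
  have cA: "?A \<in> carrier_mat n n" using A by simp
  obtain as where as: "char_poly ?A = (\<Prod>a\<leftarrow>as. [:- a, 1:])"
    using char_poly_factorized[OF cA] by blast
  have "a \<in> \<real>" if "a \<in> set as" for a
  proof -
    have "poly (char_poly ?A) a = 0"
      unfolding as using that by (force simp: poly_prod_list prod_list_zero_iff)
    then show ?thesis
      using symmetric_real_eigenvalue[OF A sym] eigenvalue_root_char_poly[OF cA] by blast
  qed
  then have "map (complex_of_real \<circ> Re) as = as"
    by (intro map_idI) (auto elim: Reals_cases)
  then have "char_poly ?A = (\<Prod>a\<leftarrow>map (complex_of_real \<circ> Re) as. [:- a, 1:])"
    by (simp only: as)
  also have "\<dots> = (\<Prod>e\<leftarrow>map Re as. [:- complex_of_real e, 1:])"
    by (simp only: map_map o_def)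
  also have "\<dots> = map_poly complex_of_real (\<Prod>e\<leftarrow>map Re as. [:- e, 1:])"
    by (simp add: map_poly_of_real.hom_prod_list o_def)
  finally have "map_poly complex_of_real (char_poly A) = map_poly complex_of_real (\<Prod>e\<leftarrow>map Re as. [:- e, 1:])"
    by (simp only: of_real_hom.char_poly_hom[OF A])
  then have "char_poly A = (\<Prod>e\<leftarrow>map Re as. [:- e, 1:])"
    by (simp only: map_poly_of_real.eq_iff)
  then show ?thesis by (rule that)
qed

lemma mat_trace_mult_comm:
  assumes "A \<in> carrier_mat n n" "B \<in> carrier_mat n n"
  shows "mat_trace (A * B) = mat_trace (B * A)"
proof -
  have "mat_trace (A * B) = (\<Sum>i<n. \<Sum>j<n. A $$ (i, j) * B $$ (j, i))"
    using assms by (simp add: mat_trace_def scalar_prod_def atLeast0LessThan)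
  also have "\<dots> = (\<Sum>j<n. \<Sum>i<n. B $$ (j, i) * A $$ (i, j))"
    by (subst sum.swap) (simp add: mult.commute)
  also have "\<dots> = mat_trace (B * A)"
    using assms by (simp add: mat_trace_def scalar_prod_def atLeast0LessThan)
  finally show ?thesis .
qed

lemma proots_prod_linear:
  "proots (\<Prod>e\<leftarrow>es. [:- e, 1:]) = mset (es :: real list)"
proof (induction es)
  case (Cons e es)
  have "(\<Prod>e\<leftarrow>es. [:- e, 1:]) \<noteq> (0 :: real poly)" by (auto simp: prod_list_zero_iff)
  then have "proots ([:- e, 1:] * (\<Prod>e\<leftarrow>es. [:- e, 1:])) = proots [:- e, 1:] + proots (\<Prod>e\<leftarrow>es. [:- e, 1:])"
    by (intro proots_mult) auto
  then show ?case by (simp add: Cons)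
qed simp

text \<open>Since the characteristic polynomial splits over the reals, Schur triangularisation is
  available there; the trace is invariant under the similarity, and the diagonal lists the roots
  with multiplicity.\<close>

lemma eig_sum_eq_trace:
  assumes A: "A \<in> carrier_mat n n" and sym: "transpose_mat A = A"
  shows "eig_sum A = mat_trace A"
proof -
  obtain es where es: "char_poly A = (\<Prod>e\<leftarrow>es. [:- e, 1:])"
    using symmetric_char_poly_splits[OF A sym] .
  obtain B P Q where "schur_decomposition A es = (B, P, Q)" by (cases "schur_decomposition A es") auto
  from schur_decomposition[OF A es this]
  have w: "similar_mat_wit A B P Q" and d: "diag_mat B = es" by auto
  from similar_mat_witD2[OF A w] have c: "B \<in> carrier_mat n n" "P \<in> carrier_mat n n" "Q \<in> carrier_mat n n"
    and i: "Q * P = 1\<^sub>m n" and AB: "A = P * B * Q" by auto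
  have "mat_trace A = mat_trace (P * (B * Q))"
    unfolding AB using c by (simp add: assoc_mult_mat)
  also have "\<dots> = mat_trace (B * Q * P)" using c by (intro mat_trace_mult_comm) auto
  also have "B * Q * P = B" using c i by (simp add: assoc_mult_mat)
  also have "mat_trace B = sum_list (diag_mat B)"
    unfolding mat_trace_def diag_mat_def
    by (simp add: interv_sum_list_conv_sum_set_nat atLeast0LessThan)
  also have "\<dots> = eig_sum A"
    by (simp add: eig_sum_def eigvals_def es proots_prod_linear d sum_mset_sum_list)
  finally show ?thesis by simp
qed

section \<open>Gaussian integration by parts for polynomials\<close>

abbreviation gauss_family :: "'e set \<Rightarrow> real \<Rightarrow> ('e \<Rightarrow> real) measure" where
  "gauss_family S \<sigma> \<equiv> PiM S (\<lambda>_. density lborel (normal_density 0 \<sigma>))"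

definition normal_moment :: "real \<Rightarrow> nat \<Rightarrow> real" where
  "normal_moment \<sigma> n = (\<integral>x. x ^ n \<partial>density lborel (normal_density 0 \<sigma>))"

lemma integrable_normal_power:
  assumes "\<sigma> > 0"
  shows "integrable (density lborel (normal_density 0 \<sigma>)) (\<lambda>x. x ^ n)"
  using integrable_normal_moment[OF assms, of 0 n] assms
  by (subst integrable_density) (auto simp: normal_density_nonneg)

lemma normal_moment_lborel:
  assumes "\<sigma> > 0"
  shows "normal_moment \<sigma> n = (\<integral>x. normal_density 0 \<sigma> x * x ^ n \<partial>lborel)"
  unfolding normal_moment_def
  using assms by (subst integral_density) (auto simp: normal_density_nonneg)

lemma normal_moment_odd_eq:
  assumes "\<sigma> > 0"
  shows "normal_moment \<sigma> (2 * k + 1) = 0"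
  using integral_normal_moment_odd[OF assms, of 0 k] by (simp add: normal_moment_lborel[OF assms])

lemma normal_moment_even_eq:
  assumes "\<sigma> > 0"
  shows "normal_moment \<sigma> (2 * k) = fact (2 * k) / ((2 / \<sigma>\<^sup>2) ^ k * fact k)"
  using integral_normal_moment_even[OF assms, of 0 k] by (simp add: normal_moment_lborel[OF assms])

lemma normal_moment_nonneg:
  assumes "\<sigma> > 0"
  shows "normal_moment \<sigma> n \<ge> 0"
proof (cases "even n")
  case True
  then obtain k where "n = 2 * k" by (elim evenE)
  then show ?thesis by (simp add: normal_moment_even_eq[OF assms])
next
  case False
  then obtain k where "n = 2 * k + 1" by (elim oddE)
  then show ?thesis by (simp only: normal_moment_odd_eq[OF assms])
qed

text \<open>Stein's identity for a monomial in one variable, read off the closed formulas for the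
  moments, so that no differentiation under the integral occurs. At n = 0 the truncated
  \<open>n - 1\<close> is harmless because of the factor n.\<close>

lemma normal_moment_Suc:
  assumes "\<sigma> > 0"
  shows "normal_moment \<sigma> (Suc n) = \<sigma>\<^sup>2 * (real n * normal_moment \<sigma> (n - 1))"
proof (cases "even n")
  case True
  then obtain k where n: "n = 2 * k" by (elim evenE)
  show ?thesis
  proof (cases k)
    case 0
    then show ?thesis using normal_moment_odd_eq[OF assms, of 0] n by simp
  next
    case (Suc j)
    then have "n - 1 = 2 * j + 1" "Suc n = 2 * k + 1" using n by auto
    then show ?thesis by (simp only: normal_moment_odd_eq[OF assms])
  qed
next
  case False
  then obtain k where n: "n = 2 * k + 1" by (elim oddE)
  have "normal_moment \<sigma> (2 * Suc k) = fact (2 * Suc k) / ((2 / \<sigma>\<^sup>2) ^ Suc k * fact (Suc k))"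
    by (rule normal_moment_even_eq[OF assms])
  also have "\<dots> = (2 * real k + 2) * (2 * real k + 1) * fact (2 * k) * \<sigma>\<^sup>2 / (2 * (real k + 1) * ((2 / \<sigma>\<^sup>2) ^ k * fact k))"
    using assms by (simp add: field_simps)
  also have "\<dots> = \<sigma>\<^sup>2 * (2 * real k + 1) * (fact (2 * k) / ((2 / \<sigma>\<^sup>2) ^ k * fact k))"
  proof -
    \<comment> \<open>The factorials are abstracted to real variables so that only the common factor
      2 (r + 1) has to be cancelled.\<close>
    have *: "(2 * r + 2) * x * f * s / (2 * (r + 1) * d) = s * x * (f / d)" if "r + 1 \<noteq> 0" for r x f s d :: real
    proof -
      have "(2 * r + 2) * x * f * s / (2 * (r + 1) * d) = (2 * (r + 1)) * (s * x * f) / ((2 * (r + 1)) * d)"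
        by (simp add: algebra_simps)
      also have "\<dots> = s * x * f / d" using that by (subst mult_divide_mult_cancel_left) auto
      finally show ?thesis by simp
    qed
    show ?thesis by (rule *) (metis add.commute of_nat_Suc of_nat_neq_0)
  qed
  also have "\<dots> = \<sigma>\<^sup>2 * (2 * real k + 1) * normal_moment \<sigma> (2 * k)"
    by (simp only: normal_moment_even_eq[OF assms])
  finally show ?thesis
    using n by simp
qed

section \<open>Monomials and polynomials with nonnegative coefficients\<close>

definition monom_fun :: "'e set \<Rightarrow> ('e \<Rightarrow> nat) \<Rightarrow> ('e \<Rightarrow> real) \<Rightarrow> real" where
  "monom_fun S m \<omega> = (\<Prod>e\<in>S. \<omega> e ^ m e)"

lemma monom_fun_mult: "monom_fun S m \<omega> * monom_fun S m' \<omega> = monom_fun S (\<lambda>e. m e + m' e) \<omega>"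
  by (simp add: monom_fun_def power_add prod.distrib)

lemma monom_fun_times_var:
  assumes "finite S" "e \<in> S"
  shows "\<omega> e * monom_fun S m \<omega> = monom_fun S (m(e := Suc (m e))) \<omega>"
  unfolding monom_fun_def prod.remove[OF assms] by (auto simp: mult_ac intro!: prod.cong)

lemma integrable_monom_fun:
  assumes "finite S" "\<sigma> > 0"
  shows "integrable (gauss_family S \<sigma>) (monom_fun S m)"
    and "integral\<^sup>L (gauss_family S \<sigma>) (monom_fun S m) = (\<Prod>e\<in>S. normal_moment \<sigma> (m e))"
proof -
  interpret product_sigma_finite "\<lambda>_ :: 'a. density lborel (normal_density 0 \<sigma>)"
    unfolding product_sigma_finite_def
    using prob_space_normal_density[OF assms(2)] by (auto intro: prob_space_imp_sigma_finite)
  show "integrable (gauss_family S \<sigma>) (monom_fun S m)"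
    unfolding monom_fun_def
    by (rule product_integrable_prod[OF assms(1) integrable_normal_power[OF assms(2)]])
  show "integral\<^sup>L (gauss_family S \<sigma>) (monom_fun S m) = (\<Prod>e\<in>S. normal_moment \<sigma> (m e))"
    unfolding monom_fun_def normal_moment_def
    by (rule product_integral_prod[OF assms(1) integrable_normal_power[OF assms(2)]])
qed

text \<open>Polynomials with nonnegative coefficients, paired with all their formal partial
  derivatives. Nonnegativity of the coefficients makes every Gaussian expectation nonnegative.\<close>
inductive nn_poly :: "'e set \<Rightarrow> (('e \<Rightarrow> real) \<Rightarrow> real) \<Rightarrow> ('e \<Rightarrow> ('e \<Rightarrow> real) \<Rightarrow> real) \<Rightarrow> bool"
  for S where
  zero: "nn_poly S (\<lambda>_. 0) (\<lambda>_ _. 0)"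
| add_monom: "nn_poly S f D \<Longrightarrow> c \<ge> 0 \<Longrightarrow>
    nn_poly S (\<lambda>\<omega>. c * monom_fun S m \<omega> + f \<omega>)
      (\<lambda>e \<omega>. c * (real (m e) * monom_fun S (m(e := m e - 1)) \<omega>) + D e \<omega>)"

text \<open>The derivative family is an argument of the predicate, so each closure rule yields it in
  one syntactic shape; this allows a pointwise equal replacement.\<close>

lemma nn_poly_cong:
  assumes "nn_poly S f D" "\<And>\<omega>. f \<omega> = g \<omega>" "\<And>e \<omega>. D e \<omega> = D' e \<omega>"
  shows "nn_poly S g D'"
proof -
  have "f = g" "D = D'" using assms by (auto intro!: ext)
  with assms(1) show ?thesis by simp
qed

lemma nn_poly_monom:
  assumes "c \<ge> 0"
  shows "nn_poly S (\<lambda>\<omega>. c * monom_fun S m \<omega>)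
      (\<lambda>e \<omega>. c * (real (m e) * monom_fun S (m(e := m e - 1)) \<omega>))"
  using nn_poly.add_monom[OF nn_poly.zero assms] by simp

lemma nn_poly_const: "c \<ge> 0 \<Longrightarrow> nn_poly S (\<lambda>_. c) (\<lambda>_ _. 0)"
  by (rule nn_poly_cong[OF nn_poly_monom[of c S "\<lambda>_. 0"]]) (auto simp: monom_fun_def)

lemma nn_poly_var:
  assumes "finite S" "e \<in> S"
  shows "nn_poly S (\<lambda>\<omega>. \<omega> e) (\<lambda>e' _. if e' = e then 1 else 0)"
proof (rule nn_poly_cong[OF nn_poly_monom[of 1 S "\<lambda>e'. if e' = e then 1 else 0"]])
  have "monom_fun S (\<lambda>e'. if e' = e then 1 else 0) \<omega> = (\<Prod>e'\<in>S. if e' = e then \<omega> e' else 1)" for \<omega>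
    unfolding monom_fun_def by (intro prod.cong) auto
  then show "1 * monom_fun S (\<lambda>e'. if e' = e then 1 else 0) \<omega> = \<omega> e" for \<omega>
    using assms by simp
  have "monom_fun S ((\<lambda>e'. if e' = e then 1 else 0)(e := 0)) \<omega> = 1" for \<omega>
    unfolding monom_fun_def by (intro prod.neutral) auto
  then show "1 * (real (if e' = e then 1 else 0) * monom_fun S
      ((\<lambda>e'. if e' = e then 1 else 0)(e' := (if e' = e then 1 else 0) - 1)) \<omega>) = (if e' = e then 1 else 0)"
    for e' \<omega> by simp
qed simp

lemma nn_poly_add:
  assumes "nn_poly S f D" "nn_poly S g D'"
  shows "nn_poly S (\<lambda>\<omega>. f \<omega> + g \<omega>) (\<lambda>e \<omega>. D e \<omega> + D' e \<omega>)"
  using assms(1)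
proof induction
  case zero
  then show ?case using assms(2) by simp
next
  case (add_monom f D c m)
  show ?case
    by (rule nn_poly_cong[OF nn_poly.add_monom[OF add_monom.IH add_monom.hyps(2), of m]]) auto
qed

text \<open>One half of the product rule. When m e = 0 the truncated exponents on the two sides may
  disagree, but the factor m e kills both.\<close>

lemma monom_fun_product_rule:
  "real (m e) * monom_fun S (m(e := m e - 1)) \<omega> * monom_fun S m' \<omega>
     = real (m e) * monom_fun S ((\<lambda>e. m e + m' e)(e := m e + m' e - 1)) \<omega>"
proof (cases "m e = 0")
  case False
  then have "(\<lambda>x. (m(e := m e - 1)) x + m' x) = (\<lambda>e. m e + m' e)(e := m e + m' e - 1)" by auto
  then show ?thesis by (simp add: mult.assoc monom_fun_mult)
qed simp

lemma nn_poly_monom_mult: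
  assumes "finite S" "c \<ge> 0" "nn_poly S f D"
  shows "nn_poly S (\<lambda>\<omega>. c * monom_fun S m \<omega> * f \<omega>)
    (\<lambda>e \<omega>. c * (real (m e) * monom_fun S (m(e := m e - 1)) \<omega>) * f \<omega> + c * monom_fun S m \<omega> * D e \<omega>)"
  using assms(3)
proof induction
  case zero
  then show ?case using nn_poly.zero by simp
next
  case (add_monom f D d m')
  have cd: "c * d \<ge> 0" using assms add_monom by simp
  show ?case
  proof (rule nn_poly_cong[OF nn_poly.add_monom[OF add_monom.IH cd, of "\<lambda>e. m e + m' e"]])
    show "c * d * monom_fun S (\<lambda>e. m e + m' e) \<omega> + c * monom_fun S m \<omega> * f \<omega>
      = c * monom_fun S m \<omega> * (d * monom_fun S m' \<omega> + f \<omega>)" for \<omega>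
      by (simp add: monom_fun_mult[symmetric] algebra_simps)
    fix e \<omega>
    let ?q = "monom_fun S ((\<lambda>e. m e + m' e)(e := m e + m' e - 1)) \<omega>"
    have 1: "real (m e) * monom_fun S (m(e := m e - 1)) \<omega> * monom_fun S m' \<omega> = real (m e) * ?q"
      by (rule monom_fun_product_rule)
    have 2: "real (m' e) * monom_fun S (m'(e := m' e - 1)) \<omega> * monom_fun S m \<omega> = real (m' e) * ?q"
      using monom_fun_product_rule[where m = m' and m' = m] by (simp add: add.commute)
    have "c * (real (m e) * monom_fun S (m(e := m e - 1)) \<omega>) * (d * monom_fun S m' \<omega>)
       + c * monom_fun S m \<omega> * (d * (real (m' e) * monom_fun S (m'(e := m' e - 1)) \<omega>))
       = c * d * (real (m e) * monom_fun S (m(e := m e - 1)) \<omega> * monom_fun S m' \<omega>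
           + real (m' e) * monom_fun S (m'(e := m' e - 1)) \<omega> * monom_fun S m \<omega>)"
      by (simp add: algebra_simps)
    also have "\<dots> = c * d * (real (m e + m' e) * ?q)"
      unfolding 1 2 by (simp add: algebra_simps)
    finally show "c * d * (real (m e + m' e) * ?q) +
        (c * (real (m e) * monom_fun S (m(e := m e - 1)) \<omega>) * f \<omega> + c * monom_fun S m \<omega> * D e \<omega>)
      = c * (real (m e) * monom_fun S (m(e := m e - 1)) \<omega>) * (d * monom_fun S m' \<omega> + f \<omega>)
       + c * monom_fun S m \<omega> * (d * (real (m' e) * monom_fun S (m'(e := m' e - 1)) \<omega>) + D e \<omega>)"
      by (simp only: distrib_left add_ac)
  qed
qed

text \<open>Together with sums, this lets expressions built recursively from the entries be
  recognised along their recursion, with the derivative coming out by the Leibniz rule.\<close>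

lemma nn_poly_mult:
  assumes "finite S" "nn_poly S f D" "nn_poly S g D'"
  shows "nn_poly S (\<lambda>\<omega>. f \<omega> * g \<omega>) (\<lambda>e \<omega>. D e \<omega> * g \<omega> + f \<omega> * D' e \<omega>)"
  using assms(2)
proof induction
  case zero
  then show ?case using nn_poly.zero by simp
next
  case (add_monom f D c m)
  show ?case
    by (rule nn_poly_cong[OF nn_poly_add[OF nn_poly_monom_mult[OF assms(1) add_monom.hyps(2) assms(3), of m]
       add_monom.IH]]) (simp_all only: distrib_right distrib_left add_ac)
qed

lemma nn_poly_sum:
  assumes "\<And>i. i \<in> A \<Longrightarrow> nn_poly S (f i) (D i)"
  shows "nn_poly S (\<lambda>\<omega>. \<Sum>i\<in>A. f i \<omega>) (\<lambda>e \<omega>. \<Sum>i\<in>A. D i e \<omega>)"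
  using assms
proof (induction A rule: infinite_finite_induct)
  case (insert x F)
  then show ?case using nn_poly_add[of S "f x" "D x"] by simp
qed (auto intro: nn_poly.zero)

text \<open>By independence a monomial has a product of one-dimensional moments as expectation, and
  these are zero in odd and positive in even degree. The inequalities in the moment recursion rest
  on this positivity.\<close>

lemma nn_poly_expectation:
  assumes "finite S" "\<sigma> > 0" "nn_poly S f D"
  shows "integrable (gauss_family S \<sigma>) f" and "integral\<^sup>L (gauss_family S \<sigma>) f \<ge> 0"
proof -
  have "integrable (gauss_family S \<sigma>) f \<and> integral\<^sup>L (gauss_family S \<sigma>) f \<ge> 0"
    using assms(3)
  proof induction
    case (add_monom f D c m)
    have "normal_moment \<sigma> (m e) \<ge> 0" for e using normal_moment_nonneg[OF assms(2)] .
    with add_monom show ?case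
      using integrable_monom_fun[OF assms(1,2), of m] by (auto intro!: mult_nonneg_nonneg add_nonneg_nonneg prod_nonneg)
  qed simp
  then show "integrable (gauss_family S \<sigma>) f" and "integral\<^sup>L (gauss_family S \<sigma>) f \<ge> 0" by auto
qed

text \<open>Both sides are linear in the polynomial, so a monomial is enough, and there only the
  factor of the variable e is touched. Integrability of the derivative is proved along, to split the
  integral.\<close>

lemma nn_poly_stein:
  assumes "finite S" "\<sigma> > 0" "nn_poly S f D" "e \<in> S"
  shows "integrable (gauss_family S \<sigma>) (D e)"
    and "(\<integral>\<omega>. \<omega> e * f \<omega> \<partial>gauss_family S \<sigma>) = \<sigma>\<^sup>2 * (\<integral>\<omega>. D e \<omega> \<partial>gauss_family S \<sigma>)"
proof -
  have i2: "integrable (gauss_family S \<sigma>) (\<lambda>\<omega>. \<omega> e * f \<omega>)" if "nn_poly S f D" for f D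
    using nn_poly_expectation(1)[OF assms(1,2) nn_poly_mult[OF assms(1) nn_poly_var[OF assms(1,4)] that]] .
  have "integrable (gauss_family S \<sigma>) (D e) \<and>
     (\<integral>\<omega>. \<omega> e * f \<omega> \<partial>gauss_family S \<sigma>) = \<sigma>\<^sup>2 * (\<integral>\<omega>. D e \<omega> \<partial>gauss_family S \<sigma>)"
    using assms(3)
  proof induction
    case (add_monom f D c m)
    note mono = integrable_monom_fun[OF assms(1,2)]
    let ?m = "m(e := m e - 1)" and ?m' = "m(e := Suc (m e))"
    have id: "\<omega> e * (c * monom_fun S m \<omega> + f \<omega>) = c * monom_fun S ?m' \<omega> + \<omega> e * f \<omega>" for \<omega>
      using monom_fun_times_var[OF assms(1,4), of \<omega> m] by (simp add: algebra_simps)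
    have rest: "(\<Prod>x\<in>S - {e}. normal_moment \<sigma> ((m(e := k)) x)) = (\<Prod>x\<in>S - {e}. normal_moment \<sigma> (m x))" for k
      by (intro prod.cong) auto
    have "(\<Prod>x\<in>S. normal_moment \<sigma> (?m' x)) = \<sigma>\<^sup>2 * (real (m e) * (\<Prod>x\<in>S. normal_moment \<sigma> (?m x)))"
      unfolding prod.remove[OF assms(1,4)] rest
      by (simp add: normal_moment_Suc[OF assms(2)])
    then have "(\<integral>\<omega>. \<omega> e * (c * monom_fun S m \<omega> + f \<omega>) \<partial>gauss_family S \<sigma>)
      = c * (\<sigma>\<^sup>2 * (real (m e) * (\<Prod>x\<in>S. normal_moment \<sigma> (?m x)))) + \<sigma>\<^sup>2 * (\<integral>\<omega>. D e \<omega> \<partial>gauss_family S \<sigma>)"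
      unfolding id using mono i2[OF add_monom.hyps(1)] add_monom.IH
      by (subst Bochner_Integration.integral_add) auto
    moreover have "integrable (gauss_family S \<sigma>) (\<lambda>\<omega>. c * (real (m e) * monom_fun S ?m \<omega>) + D e \<omega>)"
      using mono add_monom.IH by auto
    moreover have "(\<integral>\<omega>. c * (real (m e) * monom_fun S ?m \<omega>) + D e \<omega> \<partial>gauss_family S \<sigma>)
      = c * (real (m e) * (\<Prod>x\<in>S. normal_moment \<sigma> (?m x))) + (\<integral>\<omega>. D e \<omega> \<partial>gauss_family S \<sigma>)"
      using mono add_monom.IH by (subst Bochner_Integration.integral_add) auto
    ultimately show ?case by (simp add: algebra_simps)
  qed simp
  then show "integrable (gauss_family S \<sigma>) (D e)"
    "(\<integral>\<omega>. \<omega> e * f \<omega> \<partial>gauss_family S \<sigma>) = \<sigma>\<^sup>2 * (\<integral>\<omega>. D e \<omega> \<partial>gauss_family S \<sigma>)" by auto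
qed

section \<open>Powers of a symmetric Gaussian matrix\<close>

text \<open>Entries of the n-th matrix power, unfolded at the first factor: the one that is
  integrated by parts.\<close>

fun walk_sum :: "nat \<Rightarrow> (nat \<Rightarrow> nat \<Rightarrow> real) \<Rightarrow> nat \<Rightarrow> nat \<Rightarrow> nat \<Rightarrow> real" where
  "walk_sum N w 0 i j = (if i = j then 1 else 0)"
| "walk_sum N w (Suc n) i j = (\<Sum>k<N. w i k * walk_sum N w n k j)"

text \<open>Derivative of \<open>walk_sum\<close> at w in the direction \<open>d\<close>, by the
  product rule.\<close>

fun walk_deriv :: "nat \<Rightarrow> (nat \<Rightarrow> nat \<Rightarrow> real) \<Rightarrow> (nat \<Rightarrow> nat \<Rightarrow> real) \<Rightarrow> nat \<Rightarrow> nat \<Rightarrow> nat \<Rightarrow> real" where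
  "walk_deriv N w d 0 i j = 0"
| "walk_deriv N w d (Suc n) i j = (\<Sum>k<N. d i k * walk_sum N w n k j + w i k * walk_deriv N w d n k j)"

definition tr_pow :: "nat \<Rightarrow> (nat \<Rightarrow> nat \<Rightarrow> real) \<Rightarrow> nat \<Rightarrow> real" where
  "tr_pow N w n = (\<Sum>i<N. walk_sum N w n i i)"

text \<open>For \<open>K\<close> the identity this is the trace of the \<open>n\<close>-th power of \<open>w\<close>, for \<open>K\<close> constantly 1 it is
  the sum of all entries of that power; the moment recursion treats both alike.\<close>
definition pair_pow :: "nat \<Rightarrow> (nat \<Rightarrow> nat \<Rightarrow> real) \<Rightarrow> (nat \<Rightarrow> nat \<Rightarrow> real) \<Rightarrow> nat \<Rightarrow> real" where
  "pair_pow N w K n = (\<Sum>i<N. \<Sum>l<N. K i l * walk_sum N w n i l)"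

definition tr_prod :: "nat \<Rightarrow> (nat \<Rightarrow> nat \<Rightarrow> real) \<Rightarrow> nat list \<Rightarrow> real" where
  "tr_prod N w as = (\<Prod>a\<leftarrow>as. tr_pow N w a)"

definition tr_deriv :: "nat \<Rightarrow> (nat \<Rightarrow> nat \<Rightarrow> real) \<Rightarrow> (nat \<Rightarrow> nat \<Rightarrow> real) \<Rightarrow> nat \<Rightarrow> real" where
  "tr_deriv N w d n = (\<Sum>i<N. walk_deriv N w d n i i)"

fun tr_prod_deriv :: "nat \<Rightarrow> (nat \<Rightarrow> nat \<Rightarrow> real) \<Rightarrow> (nat \<Rightarrow> nat \<Rightarrow> real) \<Rightarrow> nat list \<Rightarrow> real" where
  "tr_prod_deriv N w d [] = 0"
| "tr_prod_deriv N w d (a # as) =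
     tr_deriv N w d a * tr_prod N w as + tr_pow N w a * tr_prod_deriv N w d as"

text \<open>Partial derivative of the symmetric matrix by its independent entry e. Off the diagonal
  it has two entries 1, on the diagonal only one: the source of all later exceptions for i =
  j.\<close>

definition edge_dir :: "nat \<times> nat \<Rightarrow> nat \<Rightarrow> nat \<Rightarrow> real" where
  "edge_dir e i j = (if e = (min i j, max i j) then 1 else 0)"

lemma tr_prod_simps [simp]:
  "tr_prod N w [] = 1" "tr_prod N w (a # as) = tr_pow N w a * tr_prod N w as"
  "tr_prod N w (as @ bs) = tr_prod N w as * tr_prod N w bs"
  by (simp_all add: tr_prod_def)

lemma walk_sum_add:
  assumes "i < N"
  shows "walk_sum N w (m + n) i j = (\<Sum>k<N. walk_sum N w m i k * walk_sum N w n k j)"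
  using assms
proof (induction m arbitrary: i)
  case 0
  have "(\<Sum>k<N. walk_sum N w 0 i k * walk_sum N w n k j) = (\<Sum>k<N. if i = k then walk_sum N w n k j else 0)"
    by (intro sum.cong) auto
  then show ?case using 0 by simp
next
  case (Suc m)
  have "walk_sum N w (Suc m + n) i j = (\<Sum>l<N. w i l * (\<Sum>k<N. walk_sum N w m l k * walk_sum N w n k j))"
    using Suc.IH by simp
  also have "\<dots> = (\<Sum>l<N. \<Sum>k<N. w i l * walk_sum N w m l k * walk_sum N w n k j)"
    by (simp add: sum_distrib_left mult.assoc)
  also have "\<dots> = (\<Sum>k<N. \<Sum>l<N. w i l * walk_sum N w m l k * walk_sum N w n k j)"
    by (rule sum.swap)
  finally show ?case by (simp add: sum_distrib_right)
qed

lemma walk_sum_one: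
  assumes "j < N"
  shows "walk_sum N w (Suc 0) i j = w i j"
proof -
  have "walk_sum N w (Suc 0) i j = (\<Sum>k<N. if k = j then w i k else 0)"
    unfolding walk_sum.simps by (intro sum.cong) auto
  then show ?thesis using assms by simp
qed

lemma walk_sum_sym:
  assumes "\<And>i j. w i j = w j i" "i < N" "j < N"
  shows "walk_sum N w n i j = walk_sum N w n j i"
  using assms(2,3)
proof (induction n arbitrary: i j)
  case (Suc n)
  have "walk_sum N w (n + Suc 0) j i = (\<Sum>k<N. walk_sum N w n j k * walk_sum N w (Suc 0) k i)"
    by (rule walk_sum_add[OF Suc.prems(2)])
  also have "\<dots> = (\<Sum>k<N. w i k * walk_sum N w n k j)"
    using Suc by (intro sum.cong refl) (simp add: walk_sum_one assms(1) mult.commute del: walk_sum.simps)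
  finally show ?case by simp
qed simp

section \<open>Derivatives in a single matrix entry\<close>

lemma walk_deriv_expand:
  assumes "i < N"
  shows "walk_deriv N w d n i j =
    (\<Sum>k<n. \<Sum>a<N. \<Sum>b<N. walk_sum N w k i a * d a b * walk_sum N w (n - 1 - k) b j)"
  using assms
proof (induction n arbitrary: i)
  case (Suc n)
  let ?p = "walk_sum N w"
  have "(\<Sum>a<N. \<Sum>b<N. ?p 0 i a * d a b * ?p n b j) = (\<Sum>a<N. if i = a then \<Sum>b<N. d a b * ?p n b j else 0)"
    by (intro sum.cong) auto
  then have 0: "(\<Sum>a<N. \<Sum>b<N. ?p 0 i a * d a b * ?p n b j) = (\<Sum>b<N. d i b * ?p n b j)"
    using Suc.prems by simp
  have "(\<Sum>k<N. w i k * walk_deriv N w d n k j)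
    = (\<Sum>k<N. w i k * (\<Sum>m<n. \<Sum>a<N. \<Sum>b<N. ?p m k a * d a b * ?p (n - 1 - m) b j))"
    using Suc.IH by simp
  also have "\<dots> = (\<Sum>k<N. \<Sum>m<n. \<Sum>a<N. \<Sum>b<N. w i k * ?p m k a * d a b * ?p (n - 1 - m) b j)"
    by (simp add: sum_distrib_left mult.assoc)
  also have "\<dots> = (\<Sum>m<n. \<Sum>k<N. \<Sum>a<N. \<Sum>b<N. w i k * ?p m k a * d a b * ?p (n - 1 - m) b j)"
    by (rule sum.swap)
  also have "\<dots> = (\<Sum>m<n. \<Sum>a<N. \<Sum>k<N. \<Sum>b<N. w i k * ?p m k a * d a b * ?p (n - 1 - m) b j)"
    by (rule sum.cong[OF refl]) (rule sum.swap)
  also have "\<dots> = (\<Sum>m<n. \<Sum>a<N. \<Sum>b<N. \<Sum>k<N. w i k * ?p m k a * d a b * ?p (n - 1 - m) b j)"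
    by (rule sum.cong[OF refl], rule sum.cong[OF refl]) (rule sum.swap)
  also have "\<dots> = (\<Sum>m<n. \<Sum>a<N. \<Sum>b<N. ?p (Suc m) i a * d a b * ?p (n - 1 - m) b j)"
    by (simp add: sum_distrib_right)
  finally have S: "(\<Sum>k<N. w i k * walk_deriv N w d n k j) =
    (\<Sum>m<n. \<Sum>a<N. \<Sum>b<N. ?p (Suc m) i a * d a b * ?p (Suc n - 1 - Suc m) b j)" by simp
  have "walk_deriv N w d (Suc n) i j = (\<Sum>b<N. d i b * ?p n b j) + (\<Sum>k<N. w i k * walk_deriv N w d n k j)"
    by (simp add: sum.distrib)
  also have "\<dots> = (\<Sum>k<Suc n. \<Sum>a<N. \<Sum>b<N. ?p k i a * d a b * ?p (Suc n - 1 - k) b j)"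
    unfolding S sum.lessThan_Suc_shift by (simp only: 0 diff_zero diff_Suc_1)
  finally show ?case .
qed simp

text \<open>The two orientations of an edge. For a loop they coincide, and the single contribution
  is credited to the reversed orientation, which later has to sum up to a complete trace.\<close>

lemma sum_edge_dir:
  fixes u v :: "nat \<Rightarrow> real"
  assumes "i < N" "j < N"
  shows "(\<Sum>a<N. \<Sum>b<N. u a * edge_dir (min i j, max i j) a b * v b)
    = u j * v i + (if i = j then 0 else u i * v j)"
proof -
  have "u a * edge_dir (min i j, max i j) a b * v b
     = (if a = j then if b = i then u a * v b else 0 else 0)
      + (if a = i then if b = j then if i = j then 0 else u a * v b else 0 else 0)" for a b
    by (auto simp: edge_dir_def min_def max_def split: if_splits)
  then have "(\<Sum>a<N. \<Sum>b<N. u a * edge_dir (min i j, max i j) a b * v b)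
    = (\<Sum>a<N. \<Sum>b<N. if a = j then if b = i then u a * v b else 0 else 0)
      + (\<Sum>a<N. \<Sum>b<N. if a = i then if b = j then if i = j then 0 else u a * v b else 0 else 0)"
    by (simp only: sum.distrib)
  also have "(\<Sum>a<N. \<Sum>b<N. if a = j then if b = i then u a * v b else 0 else 0)
     = (\<Sum>a<N. if a = j then \<Sum>b<N. if b = i then u a * v b else 0 else 0)"
    by (intro sum.cong) auto
  also have "\<dots> = u j * v i" using assms by simp
  also have "(\<Sum>a<N. \<Sum>b<N. if a = i then if b = j then if i = j then 0 else u a * v b else 0 else 0)
     = (\<Sum>a<N. if a = i then \<Sum>b<N. if b = j then if i = j then 0 else u a * v b else 0 else 0)"
    by (intro sum.cong) auto
  also have "\<dots> = (if i = j then 0 else u i * v j)" using assms by simp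
  finally show ?thesis .
qed

lemma walk_deriv_edge:
  assumes "i < N" "j < N" "x < N"
  shows "walk_deriv N w (edge_dir (min i j, max i j)) n x y =
    (\<Sum>k<n. walk_sum N w k x j * walk_sum N w (n - 1 - k) i y
      + (if i = j then 0 else walk_sum N w k x i * walk_sum N w (n - 1 - k) j y))"
  unfolding walk_deriv_expand[OF assms(3)] sum_edge_dir[OF assms(1,2)] ..

text \<open>By cyclicity of the trace each of the a positions of the differentiated factor
  contributes the same entry. For a = 0 the truncated exponent is masked by the factor a.\<close>

lemma tr_deriv_edge:
  assumes sym: "\<And>i j. w i j = w j i" and ij: "i < N" "j < N"
  shows "tr_deriv N w (edge_dir (min i j, max i j)) a =
    real a * walk_sum N w (a - 1) i j + (if i = j then 0 else real a * walk_sum N w (a - 1) i j)"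
proof -
  let ?p = "walk_sum N w"
  have conv: "(\<Sum>x<N. ?p k x v * ?p (a - 1 - k) u x) = ?p (a - 1) u v" if "k < a" "u < N" for k u v
  proof -
    have "?p (a - 1 - k + k) u v = (\<Sum>x<N. ?p (a - 1 - k) u x * ?p k x v)"
      by (rule walk_sum_add[OF that(2)])
    moreover have "a - 1 - k + k = a - 1" using that by simp
    ultimately show ?thesis by (simp add: mult.commute)
  qed
  have "tr_deriv N w (edge_dir (min i j, max i j)) a
    = (\<Sum>x<N. \<Sum>k<a. ?p k x j * ?p (a - 1 - k) i x + (if i = j then 0 else ?p k x i * ?p (a - 1 - k) j x))"
    unfolding tr_deriv_def by (intro sum.cong refl) (simp only: walk_deriv_edge[OF ij] lessThan_iff)
  also have "\<dots> = (\<Sum>k<a. \<Sum>x<N. ?p k x j * ?p (a - 1 - k) i x + (if i = j then 0 else ?p k x i * ?p (a - 1 - k) j x))"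
    by (rule sum.swap)
  also have "\<dots> = (\<Sum>k<a. ?p (a - 1) i j + (if i = j then 0 else ?p (a - 1) j i))"
  proof (intro sum.cong refl)
    fix k assume "k \<in> {..<a}"
    then show "(\<Sum>x<N. ?p k x j * ?p (a - 1 - k) i x + (if i = j then 0 else ?p k x i * ?p (a - 1 - k) j x))
      = ?p (a - 1) i j + (if i = j then 0 else ?p (a - 1) j i)"
      using conv[of k i j] conv[of k j i] ij by (cases "i = j") (simp_all add: sum.distrib)
  qed
  also have "?p (a - 1) j i = ?p (a - 1) i j" using walk_sum_sym[OF sym ij(2,1)] .
  finally show ?thesis by (simp add: algebra_simps)
qed

section \<open>Terms of the pairing expansion\<close>

definition offdiag_part :: "nat \<Rightarrow> (nat \<Rightarrow> nat \<Rightarrow> real) \<Rightarrow> (nat \<Rightarrow> nat \<Rightarrow> real) \<Rightarrow> nat \<Rightarrow> nat \<Rightarrow> real" where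
  "offdiag_part N w K k m =
     (\<Sum>i<N. \<Sum>l<N. \<Sum>j<N. if i = j then 0 else K i l * (walk_sum N w k j i * walk_sum N w m j l))"

text \<open>\<open>offdiag_part\<close> stems from meeting the partner factor in the same
  orientation and lacks the terms i = j; those terms are collected here.\<close>

definition diag_part :: "nat \<Rightarrow> (nat \<Rightarrow> nat \<Rightarrow> real) \<Rightarrow> (nat \<Rightarrow> nat \<Rightarrow> real) \<Rightarrow> nat \<Rightarrow> nat \<Rightarrow> real" where
  "diag_part N w K k m = (\<Sum>i<N. \<Sum>l<N. K i l * (walk_sum N w k i i * walk_sum N w m i l))"

text \<open>Turning the walk from j to i around by symmetry and summing over the junction j joins
  both walks into one. No closed walk splits off, so these pairings fall short by a factor
  N.\<close>

lemma offdiag_plus_diag: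
  assumes sym: "\<And>i j. w i j = w j i"
  shows "offdiag_part N w K k m + diag_part N w K k m = pair_pow N w K (k + m)"
proof -
  let ?p = "walk_sum N w"
  have "(\<Sum>j<N. if i = j then 0 else K i l * (?p k j i * ?p m j l)) + K i l * (?p k i i * ?p m i l)
     = K i l * ?p (k + m) i l" if "i < N" for i l
  proof -
    have "K i l * (?p k i i * ?p m i l) = (\<Sum>j<N. if i = j then K i l * (?p k j i * ?p m j l) else 0)"
      using that by simp
    then have "(\<Sum>j<N. if i = j then 0 else K i l * (?p k j i * ?p m j l)) + K i l * (?p k i i * ?p m i l)
      = (\<Sum>j<N. (if i = j then 0 else K i l * (?p k j i * ?p m j l)) + (if i = j then K i l * (?p k j i * ?p m j l) else 0))"
      by (simp only: sum.distrib)
    also have "\<dots> = (\<Sum>j<N. K i l * (?p k i j * ?p m j l))"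
      using walk_sum_sym[where n = k, OF sym that] by (intro sum.cong) auto
    also have "\<dots> = K i l * ?p (k + m) i l"
      by (simp add: walk_sum_add[OF that] sum_distrib_left)
    finally show ?thesis .
  qed
  then show ?thesis
    unfolding offdiag_part_def diag_part_def pair_pow_def sum.distrib[symmetric]
    by (intro sum.cong) auto
qed

text \<open>Summed over j, the walk returning from j to j is detached from i and l and becomes a
  full trace, while the rest runs from i to l: this is the leading term.\<close>

lemma pair_deriv_sum:
  "(\<Sum>i<N. \<Sum>l<N. \<Sum>j<N. K i l * walk_deriv N w (edge_dir (min i j, max i j)) L j l)
    = (\<Sum>k<L. tr_pow N w k * pair_pow N w K (L - 1 - k) + offdiag_part N w K k (L - 1 - k))"
proof -
  let ?p = "walk_sum N w"
  have "(\<Sum>i<N. \<Sum>l<N. \<Sum>j<N. K i l * walk_deriv N w (edge_dir (min i j, max i j)) L j l)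
    = (\<Sum>i<N. \<Sum>l<N. \<Sum>j<N. \<Sum>k<L. K i l * (?p k j j * ?p (L - 1 - k) i l)
        + (if i = j then 0 else K i l * (?p k j i * ?p (L - 1 - k) j l)))"
    by (intro sum.cong refl) (auto simp: walk_deriv_edge sum_distrib_left distrib_left intro!: sum.cong)
  also have "\<dots> = (\<Sum>i<N. \<Sum>l<N. \<Sum>k<L. \<Sum>j<N. K i l * (?p k j j * ?p (L - 1 - k) i l)
        + (if i = j then 0 else K i l * (?p k j i * ?p (L - 1 - k) j l)))"
    by (rule sum.cong[OF refl], rule sum.cong[OF refl]) (rule sum.swap)
  also have "\<dots> = (\<Sum>i<N. \<Sum>k<L. \<Sum>l<N. \<Sum>j<N. K i l * (?p k j j * ?p (L - 1 - k) i l)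
        + (if i = j then 0 else K i l * (?p k j i * ?p (L - 1 - k) j l)))"
    by (rule sum.cong[OF refl]) (rule sum.swap)
  also have "\<dots> = (\<Sum>k<L. \<Sum>i<N. \<Sum>l<N. \<Sum>j<N. K i l * (?p k j j * ?p (L - 1 - k) i l)
        + (if i = j then 0 else K i l * (?p k j i * ?p (L - 1 - k) j l)))"
    by (rule sum.swap)
  also have "\<dots> = (\<Sum>k<L. (\<Sum>i<N. \<Sum>l<N. \<Sum>j<N. K i l * (?p k j j * ?p (L - 1 - k) i l))
        + offdiag_part N w K k (L - 1 - k))"
    by (simp only: sum.distrib offdiag_part_def)
  also have "\<dots> = (\<Sum>k<L. tr_pow N w k * pair_pow N w K (L - 1 - k) + offdiag_part N w K k (L - 1 - k))"
  proof (intro sum.cong refl arg_cong2[of _ _ _ _ "(+)"])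
    fix k
    have "(\<Sum>i<N. \<Sum>l<N. \<Sum>j<N. K i l * (?p k j j * ?p (L - 1 - k) i l))
      = (\<Sum>i<N. \<Sum>l<N. tr_pow N w k * (K i l * ?p (L - 1 - k) i l))"
      unfolding tr_pow_def sum_distrib_right by (intro sum.cong refl) (simp only: mult_ac)
    then show "(\<Sum>i<N. \<Sum>l<N. \<Sum>j<N. K i l * (?p k j j * ?p (L - 1 - k) i l)) = tr_pow N w k * pair_pow N w K (L - 1 - k)"
      by (simp only: pair_pow_def sum_distrib_left)
  qed
  finally show ?thesis .
qed

text \<open>Contribution of the first factor of the walk paired with a factor inside the trace of
  the a-th power.\<close>

definition cross_one :: "nat \<Rightarrow> (nat \<Rightarrow> nat \<Rightarrow> real) \<Rightarrow> (nat \<Rightarrow> nat \<Rightarrow> real) \<Rightarrow> nat \<Rightarrow> nat \<Rightarrow> real" where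
  "cross_one N w K L a =
     (\<Sum>i<N. \<Sum>l<N. \<Sum>j<N. K i l * (walk_sum N w L j l * tr_deriv N w (edge_dir (min i j, max i j)) a))"

text \<open>Cutting the closed walk at the paired factor inserts its remaining a - 1 steps into the
  open walk. Two orientations and a positions give the constant 2 a; \<open>diag_part\<close>
  supplies the second orientation on the diagonal, which \<open>edge_dir\<close> counts
  once.\<close>

lemma cross_one_eq:
  assumes sym: "\<And>i j. w i j = w j i"
  shows "cross_one N w K L a + real a * diag_part N w K (a - 1) L = 2 * real a * pair_pow N w K (L + a - 1)"
proof (cases "a = 0")
  case True
  have "tr_deriv N w d 0 = 0" for d by (simp add: tr_deriv_def)
  with True show ?thesis by (simp add: cross_one_def)
next
  case False
  let ?p = "walk_sum N w"
  have "cross_one N w K L a = (\<Sum>i<N. \<Sum>l<N. \<Sum>j<N.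
      real a * (K i l * (?p (a - 1) i j * ?p L j l)) + real a * (if i = j then 0 else K i l * (?p (a - 1) j i * ?p L j l)))"
    unfolding cross_one_def
  proof (intro sum.cong refl)
    fix i l j assume "i \<in> {..<N}" "j \<in> {..<N}"
    then have ij: "i < N" "j < N" by auto
    show "K i l * (?p L j l * tr_deriv N w (edge_dir (min i j, max i j)) a) =
       real a * (K i l * (?p (a - 1) i j * ?p L j l)) + real a * (if i = j then 0 else K i l * (?p (a - 1) j i * ?p L j l))"
      using walk_sum_sym[where n = "a - 1", OF sym ij] by (simp add: tr_deriv_edge[OF sym ij] algebra_simps)
  qed
  also have "\<dots> = (\<Sum>i<N. \<Sum>l<N. \<Sum>j<N. real a * (K i l * (?p (a - 1) i j * ?p L j l))) + real a * offdiag_part N w K (a - 1) L"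
    by (simp only: sum.distrib offdiag_part_def sum_distrib_left)
  also have "(\<Sum>i<N. \<Sum>l<N. \<Sum>j<N. real a * (K i l * (?p (a - 1) i j * ?p L j l))) = real a * pair_pow N w K (a - 1 + L)"
    unfolding pair_pow_def sum_distrib_left
    by (intro sum.cong refl) (simp add: walk_sum_add sum_distrib_left)
  finally have "cross_one N w K L a + real a * diag_part N w K (a - 1) L =
    real a * pair_pow N w K (a - 1 + L) + real a * (offdiag_part N w K (a - 1) L + diag_part N w K (a - 1) L)"
    by (simp add: algebra_simps)
  also have "\<dots> = 2 * real a * pair_pow N w K (L + a - 1)"
    using False unfolding offdiag_plus_diag[OF sym] by (simp add: add.commute[of "a - Suc 0"])
  finally show ?thesis .
qed

definition cross_sum :: "nat \<Rightarrow> (nat \<Rightarrow> nat \<Rightarrow> real) \<Rightarrow> (nat \<Rightarrow> nat \<Rightarrow> real) \<Rightarrow> nat \<Rightarrow> nat list \<Rightarrow> real" where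
  "cross_sum N w K L as =
     (\<Sum>i<N. \<Sum>l<N. \<Sum>j<N. K i l * (walk_sum N w L j l * tr_prod_deriv N w (edge_dir (min i j, max i j)) as))"

text \<open>\<open>cross_bound\<close> majorises \<open>cross_sum\<close> coefficientwise: their difference \<open>cross_slack\<close>
  again has nonnegative coefficients.\<close>
fun cross_bound :: "nat \<Rightarrow> (nat \<Rightarrow> nat \<Rightarrow> real) \<Rightarrow> (nat \<Rightarrow> nat \<Rightarrow> real) \<Rightarrow> nat \<Rightarrow> nat list \<Rightarrow> real" where
  "cross_bound N w K L [] = 0"
| "cross_bound N w K L (a # as) =
     2 * real a * pair_pow N w K (L + a - 1) * tr_prod N w as + tr_pow N w a * cross_bound N w K L as"

lemma cross_sum_simps [simp]:
  "cross_sum N w K L [] = 0"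
  "cross_sum N w K L (a # as) = cross_one N w K L a * tr_prod N w as + tr_pow N w a * cross_sum N w K L as"
proof -
  show "cross_sum N w K L [] = 0" by (simp add: cross_sum_def)
  show "cross_sum N w K L (a # as) = cross_one N w K L a * tr_prod N w as + tr_pow N w a * cross_sum N w K L as"
    unfolding cross_sum_def cross_one_def sum_distrib_left sum_distrib_right sum.distrib[symmetric]
    by (intro sum.cong refl) (simp add: algebra_simps)
qed

fun cross_slack :: "nat \<Rightarrow> (nat \<Rightarrow> nat \<Rightarrow> real) \<Rightarrow> (nat \<Rightarrow> nat \<Rightarrow> real) \<Rightarrow> nat \<Rightarrow> nat list \<Rightarrow> real" where
  "cross_slack N w K L [] = 0"
| "cross_slack N w K L (a # as) =
     real a * diag_part N w K (a - 1) L * tr_prod N w as + tr_pow N w a * cross_slack N w K L as"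

lemma cross_bound_eq:
  assumes "\<And>i j. w i j = w j i"
  shows "cross_bound N w K L as = cross_sum N w K L as + cross_slack N w K L as"
proof (induction as)
  case (Cons a as)
  have "cross_bound N w K L (a # as) = (cross_one N w K L a + real a * diag_part N w K (a - 1) L) * tr_prod N w as
     + tr_pow N w a * (cross_sum N w K L as + cross_slack N w K L as)"
    by (simp only: cross_bound.simps Cons.IH cross_one_eq[OF assms])
  then show ?case by (simp add: algebra_simps)
qed simp

section \<open>The random symmetric matrix and its expectations\<close>

lemma sym_entry_commute: "sym_entry \<omega> i j = sym_entry \<omega> j i"
  by (simp add: sym_entry_def min.commute max.commute)

lemma finite_upper_idx: "finite (upper_idx N)"
proof -
  have "upper_idx N \<subseteq> {..<N} \<times> {..<N}" by (auto simp: upper_idx_def)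
  then show ?thesis by (rule finite_subset) auto
qed

lemma min_max_in_upper_idx: "i < N \<Longrightarrow> j < N \<Longrightarrow> (min i j, max i j) \<in> upper_idx N"
  by (auto simp: upper_idx_def)

text \<open>Identifies the explicit \<open>walk_deriv\<close> with the formal derivative carried by
  \<open>nn_poly\<close>, the link that makes Stein's identity applicable to walks.\<close>

lemma nn_poly_walk_sum:
  assumes "i < N"
  shows "nn_poly (upper_idx N) (\<lambda>\<omega>. walk_sum N (sym_entry \<omega>) n i j)
    (\<lambda>e \<omega>. walk_deriv N (sym_entry \<omega>) (edge_dir e) n i j)"
  using assms
proof (induction n arbitrary: i)
  case 0
  show ?case by (simp add: nn_poly_const)
next
  case (Suc n)
  have v: "nn_poly (upper_idx N) (\<lambda>\<omega>. sym_entry \<omega> i k) (\<lambda>e _. edge_dir e i k)" if "k < N" for k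
    unfolding sym_entry_def edge_dir_def
    by (rule nn_poly_var[OF finite_upper_idx min_max_in_upper_idx[OF Suc.prems that]])
  show ?case
    unfolding walk_sum.simps walk_deriv.simps
    by (intro nn_poly_sum nn_poly_mult[OF finite_upper_idx] v Suc.IH) auto
qed

lemma nn_poly_tr_pow:
  "nn_poly (upper_idx N) (\<lambda>\<omega>. tr_pow N (sym_entry \<omega>) n) (\<lambda>e \<omega>. tr_deriv N (sym_entry \<omega>) (edge_dir e) n)"
  unfolding tr_pow_def tr_deriv_def by (intro nn_poly_sum nn_poly_walk_sum) auto

lemma nn_poly_tr_prod:
  "nn_poly (upper_idx N) (\<lambda>\<omega>. tr_prod N (sym_entry \<omega>) as)
    (\<lambda>e \<omega>. tr_prod_deriv N (sym_entry \<omega>) (edge_dir e) as)"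
proof (induction as)
  case Nil
  show ?case by (simp add: nn_poly_const)
next
  case (Cons a as)
  show ?case
    unfolding tr_prod_simps tr_prod_deriv.simps
    by (rule nn_poly_mult[OF finite_upper_idx nn_poly_tr_pow Cons.IH])
qed

text \<open>Polynomials in the matrix with the derivative forgotten: integrability and nonnegativity
  of expectations need no more.\<close>

definition nn_stat :: "nat \<Rightarrow> ((nat \<Rightarrow> nat \<Rightarrow> real) \<Rightarrow> real) \<Rightarrow> bool" where
  "nn_stat N f \<longleftrightarrow> (\<exists>D. nn_poly (upper_idx N) (\<lambda>\<omega>. f (sym_entry \<omega>)) D)"

definition wig_exp :: "nat \<Rightarrow> real \<Rightarrow> ((nat \<Rightarrow> nat \<Rightarrow> real) \<Rightarrow> real) \<Rightarrow> real" where
  "wig_exp N \<sigma> f = (\<integral>\<omega>. f (sym_entry \<omega>) \<partial>gauss_family (upper_idx N) \<sigma>)"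

lemma nn_stat_closure:
  "c \<ge> 0 \<Longrightarrow> nn_stat N (\<lambda>_. c)"
  "nn_stat N f \<Longrightarrow> nn_stat N g \<Longrightarrow> nn_stat N (\<lambda>w. f w + g w)"
  "nn_stat N f \<Longrightarrow> nn_stat N g \<Longrightarrow> nn_stat N (\<lambda>w. f w * g w)"
  unfolding nn_stat_def
  using nn_poly_const nn_poly_add nn_poly_mult[OF finite_upper_idx] by blast+

lemma nn_stat_sum:
  assumes "\<And>i. i \<in> A \<Longrightarrow> nn_stat N (f i)"
  shows "nn_stat N (\<lambda>w. \<Sum>i\<in>A. f i w)"
proof -
  from assms have "\<forall>i\<in>A. \<exists>D. nn_poly (upper_idx N) (\<lambda>\<omega>. f i (sym_entry \<omega>)) D"
    by (auto simp: nn_stat_def)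
  then obtain D where "\<forall>i\<in>A. nn_poly (upper_idx N) (\<lambda>\<omega>. f i (sym_entry \<omega>)) (D i)" by metis
  then show ?thesis unfolding nn_stat_def by (intro exI[of _ "\<lambda>e \<omega>. \<Sum>i\<in>A. D i e \<omega>"] nn_poly_sum) auto
qed

lemma nn_stat_walk_sum: "i < N \<Longrightarrow> nn_stat N (\<lambda>w. walk_sum N w n i j)"
  unfolding nn_stat_def using nn_poly_walk_sum by blast

lemma nn_stat_tr_pow: "nn_stat N (\<lambda>w. tr_pow N w n)"
  unfolding nn_stat_def using nn_poly_tr_pow by blast

lemma nn_stat_tr_prod: "nn_stat N (\<lambda>w. tr_prod N w as)"
  unfolding nn_stat_def using nn_poly_tr_prod by blast

lemma nn_stat_pair_pow:
  assumes "\<And>i l. K i l \<ge> 0"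
  shows "nn_stat N (\<lambda>w. pair_pow N w K n)"
  unfolding pair_pow_def
  by (intro nn_stat_sum nn_stat_closure nn_stat_walk_sum assms) auto

lemma nn_stat_diag_part:
  assumes "\<And>i l. K i l \<ge> 0"
  shows "nn_stat N (\<lambda>w. diag_part N w K k m)"
  unfolding diag_part_def
  by (intro nn_stat_sum nn_stat_closure nn_stat_walk_sum assms) auto

lemma nn_stat_offdiag_part:
  assumes "\<And>i l. K i l \<ge> 0"
  shows "nn_stat N (\<lambda>w. offdiag_part N w K k m)"
proof -
  have "nn_stat N (\<lambda>w. if i = j then 0 else K i l * (walk_sum N w k j i * walk_sum N w m j l))"
    if "j < N" for i j l
    using that by (cases "i = j") (auto intro!: nn_stat_closure nn_stat_walk_sum assms)
  then show ?thesis
    unfolding offdiag_part_def by (intro nn_stat_sum) auto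
qed

text \<open>The derivatives inside \<open>cross_one\<close> come without an \<open>nn_poly\<close>
  witness of their own; the closed form of \<open>tr_deriv\<close> shows that their coefficients are
  nonnegative.\<close>

lemma nn_stat_cross_one:
  assumes "\<And>i l. K i l \<ge> 0"
  shows "nn_stat N (\<lambda>w. cross_one N w K L a)"
proof -
  have "nn_stat N (\<lambda>w. tr_deriv N w (edge_dir (min i j, max i j)) a)" if ij: "i < N" "j < N" for i j
  proof -
    have "nn_stat N (\<lambda>w. real a * walk_sum N w (a - 1) i j + (if i = j then 0 else real a * walk_sum N w (a - 1) i j))"
      using ij by (cases "i = j") (auto intro!: nn_stat_closure nn_stat_walk_sum)
    then show ?thesis
      unfolding nn_stat_def tr_deriv_edge[OF sym_entry_commute ij] .
  qed
  then show ?thesis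
    unfolding cross_one_def by (intro nn_stat_sum nn_stat_closure nn_stat_walk_sum assms) auto
qed

lemma nn_stat_cross_sum:
  assumes "\<And>i l. K i l \<ge> 0"
  shows "nn_stat N (\<lambda>w. cross_sum N w K L as)"
  by (induction as) (auto intro!: nn_stat_closure nn_stat_cross_one assms nn_stat_tr_prod nn_stat_tr_pow)

lemma nn_stat_cross_slack:
  assumes "\<And>i l. K i l \<ge> 0"
  shows "nn_stat N (\<lambda>w. cross_slack N w K L as)"
  by (induction as) (auto intro!: nn_stat_closure nn_stat_diag_part assms nn_stat_tr_prod nn_stat_tr_pow)

lemma nn_stat_cross_bound:
  assumes "\<And>i l. K i l \<ge> 0"
  shows "nn_stat N (\<lambda>w. cross_bound N w K L as)"
  by (induction as) (auto intro!: nn_stat_closure nn_stat_pair_pow assms nn_stat_tr_prod nn_stat_tr_pow)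

lemma nn_stat_integrable:
  "\<sigma> > 0 \<Longrightarrow> nn_stat N f \<Longrightarrow> integrable (gauss_family (upper_idx N) \<sigma>) (\<lambda>\<omega>. f (sym_entry \<omega>))"
  unfolding nn_stat_def using nn_poly_expectation(1)[OF finite_upper_idx] by blast

lemma wig_exp_nonneg: "\<sigma> > 0 \<Longrightarrow> nn_stat N f \<Longrightarrow> wig_exp N \<sigma> f \<ge> 0"
  unfolding nn_stat_def wig_exp_def using nn_poly_expectation(2)[OF finite_upper_idx] by blast

lemma wig_exp_add:
  "\<sigma> > 0 \<Longrightarrow> nn_stat N f \<Longrightarrow> nn_stat N g \<Longrightarrow> wig_exp N \<sigma> (\<lambda>w. f w + g w) = wig_exp N \<sigma> f + wig_exp N \<sigma> g"
  unfolding wig_exp_def by (intro Bochner_Integration.integral_add nn_stat_integrable)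

lemma wig_exp_sum:
  "\<sigma> > 0 \<Longrightarrow> (\<And>i. i \<in> A \<Longrightarrow> nn_stat N (f i)) \<Longrightarrow>
    wig_exp N \<sigma> (\<lambda>w. \<Sum>i\<in>A. f i w) = (\<Sum>i\<in>A. wig_exp N \<sigma> (f i))"
  unfolding wig_exp_def by (intro Bochner_Integration.integral_sum nn_stat_integrable)

text \<open>Assumes integrability rather than \<open>nn_stat\<close>, since the integrands left by
  Stein's identity are derivatives and are only known to be integrable.\<close>

lemma wig_exp_sum3:
  assumes F: "\<And>i l j. i < N \<Longrightarrow> j < N \<Longrightarrow> integrable (gauss_family (upper_idx N) \<sigma>) (\<lambda>\<omega>. F i l j (sym_entry \<omega>))"
  shows "wig_exp N \<sigma> (\<lambda>w. \<Sum>i<N. \<Sum>l<N. \<Sum>j<N. F i l j w) = (\<Sum>i<N. \<Sum>l<N. \<Sum>j<N. wig_exp N \<sigma> (F i l j))"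
proof -
  let ?M = "gauss_family (upper_idx N) \<sigma>"
  have "(\<integral>\<omega>. (\<Sum>i<N. \<Sum>l<N. \<Sum>j<N. F i l j (sym_entry \<omega>)) \<partial>?M) = (\<Sum>i<N. \<integral>\<omega>. (\<Sum>l<N. \<Sum>j<N. F i l j (sym_entry \<omega>)) \<partial>?M)"
    by (rule Bochner_Integration.integral_sum) (auto intro!: Bochner_Integration.integrable_sum F)
  also have "\<dots> = (\<Sum>i<N. \<Sum>l<N. \<integral>\<omega>. (\<Sum>j<N. F i l j (sym_entry \<omega>)) \<partial>?M)"
    by (rule sum.cong[OF refl], rule Bochner_Integration.integral_sum)
      (auto intro!: Bochner_Integration.integrable_sum F)
  also have "\<dots> = (\<Sum>i<N. \<Sum>l<N. \<Sum>j<N. \<integral>\<omega>. F i l j (sym_entry \<omega>) \<partial>?M)"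
    by (rule sum.cong[OF refl], rule sum.cong[OF refl], rule Bochner_Integration.integral_sum) (auto intro!: F)
  finally show ?thesis by (simp only: wig_exp_def)
qed

lemma wig_exp_cmult: "wig_exp N \<sigma> (\<lambda>w. c * f w) = c * wig_exp N \<sigma> f"
  unfolding wig_exp_def by simp

lemma wig_exp_const: "\<sigma> > 0 \<Longrightarrow> wig_exp N \<sigma> (\<lambda>_. c) = c"
proof -
  assume "\<sigma> > 0"
  then interpret prob_space "gauss_family (upper_idx N) \<sigma>"
    by (intro prob_space_PiM prob_space_normal_density)
  show ?thesis by (simp add: wig_exp_def prob_space)
qed

text \<open>Reversal of walks requires symmetry; under the integral every matrix is a
  \<open>sym_entry\<close>, so identities for symmetric matrices may be used there.\<close>

lemma wig_exp_cong_sym: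
  assumes "\<And>w. (\<And>i j. w i j = w j i) \<Longrightarrow> f w = g w"
  shows "wig_exp N \<sigma> f = wig_exp N \<sigma> g"
  unfolding wig_exp_def using assms[OF sym_entry_commute] by simp

section \<open>The moment recursion\<close>

definition moment :: "nat \<Rightarrow> real \<Rightarrow> (nat \<Rightarrow> nat \<Rightarrow> real) \<Rightarrow> nat \<Rightarrow> nat list \<Rightarrow> real" where
  "moment N \<sigma> K L as = wig_exp N \<sigma> (\<lambda>w. pair_pow N w K L * tr_prod N w as)"

lemma wig_exp_stein:
  assumes \<sigma>: "\<sigma> > 0" and ij: "i < N" "j < N"
  shows "wig_exp N \<sigma> (\<lambda>w. w i j * (walk_sum N w L j l * tr_prod N w as)) =
    \<sigma>\<^sup>2 * wig_exp N \<sigma> (\<lambda>w. walk_deriv N w (edge_dir (min i j, max i j)) L j l * tr_prod N w as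
      + walk_sum N w L j l * tr_prod_deriv N w (edge_dir (min i j, max i j)) as)"
  using nn_poly_stein(2)[OF finite_upper_idx \<sigma> nn_poly_mult[OF finite_upper_idx
        nn_poly_walk_sum[OF ij(2)] nn_poly_tr_prod] min_max_in_upper_idx[OF ij]]
  unfolding wig_exp_def sym_entry_def[symmetric] .

lemma integrable_stein:
  assumes \<sigma>: "\<sigma> > 0" and ij: "i < N" "j < N"
  shows "integrable (gauss_family (upper_idx N) \<sigma>)
     (\<lambda>\<omega>. walk_deriv N (sym_entry \<omega>) (edge_dir (min i j, max i j)) L j l * tr_prod N (sym_entry \<omega>) as
      + walk_sum N (sym_entry \<omega>) L j l * tr_prod_deriv N (sym_entry \<omega>) (edge_dir (min i j, max i j)) as)"
  using nn_poly_stein(1)[OF finite_upper_idx \<sigma> nn_poly_mult[OF finite_upper_idx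
        nn_poly_walk_sum[OF ij(2)] nn_poly_tr_prod] min_max_in_upper_idx[OF ij]] .

text \<open>Exact: the first factor of the walk is integrated by parts, and the derivative hits
  either another factor of the walk or one of the traces. The deterministic weight \<open>K\<close>
  passes through.\<close>

lemma moment_Suc_stein:
  assumes \<sigma>: "\<sigma> > 0" and K: "\<And>i l. K i l \<ge> 0"
  shows "moment N \<sigma> K (Suc L) as = \<sigma>\<^sup>2 * wig_exp N \<sigma> (\<lambda>w.
     (\<Sum>k<L. tr_pow N w k * pair_pow N w K (L - 1 - k) + offdiag_part N w K k (L - 1 - k)) * tr_prod N w as
       + cross_sum N w K L as)"
proof -
  let ?d = "\<lambda>i j. edge_dir (min i j, max i j)"
  let ?g = "\<lambda>i l j w. walk_deriv N w (?d i j) L j l * tr_prod N w as + walk_sum N w L j l * tr_prod_deriv N w (?d i j) as"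
  have v: "nn_stat N (\<lambda>w. w i j)" if "i < N" "j < N" for i j
    using nn_stat_walk_sum[OF that(1), of "Suc 0" j] unfolding walk_sum_one[OF that(2)] .
  have "moment N \<sigma> K (Suc L) as = wig_exp N \<sigma> (\<lambda>w. \<Sum>i<N. \<Sum>l<N. \<Sum>j<N. K i l * (w i j * (walk_sum N w L j l * tr_prod N w as)))"
    unfolding moment_def pair_pow_def walk_sum.simps sum_distrib_left sum_distrib_right by (simp only: mult_ac)
  also have "\<dots> = (\<Sum>i<N. \<Sum>l<N. \<Sum>j<N. K i l * wig_exp N \<sigma> (\<lambda>w. w i j * (walk_sum N w L j l * tr_prod N w as)))"
  proof -
    have "nn_stat N (\<lambda>w. K i l * (w i j * (walk_sum N w L j l * tr_prod N w as)))" if "i < N" "j < N" for i l j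
      using that by (intro nn_stat_closure K v nn_stat_walk_sum nn_stat_tr_prod)
    from wig_exp_sum3[OF nn_stat_integrable[OF \<sigma> this]] show ?thesis by (simp only: wig_exp_cmult)
  qed
  also have "\<dots> = (\<Sum>i<N. \<Sum>l<N. \<Sum>j<N. \<sigma>\<^sup>2 * (K i l * wig_exp N \<sigma> (?g i l j)))"
    by (intro sum.cong refl) (simp add: wig_exp_stein[OF \<sigma>])
  also have "\<dots> = \<sigma>\<^sup>2 * (\<Sum>i<N. \<Sum>l<N. \<Sum>j<N. wig_exp N \<sigma> (\<lambda>w. K i l * ?g i l j w))"
    by (simp only: sum_distrib_left wig_exp_cmult)
  also have "(\<Sum>i<N. \<Sum>l<N. \<Sum>j<N. wig_exp N \<sigma> (\<lambda>w. K i l * ?g i l j w))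
     = wig_exp N \<sigma> (\<lambda>w. \<Sum>i<N. \<Sum>l<N. \<Sum>j<N. K i l * ?g i l j w)"
    by (rule wig_exp_sum3[symmetric]) (intro integrable_mult_right integrable_stein[OF \<sigma>])
  also have "(\<lambda>w. \<Sum>i<N. \<Sum>l<N. \<Sum>j<N. K i l * ?g i l j w) = (\<lambda>w.
     (\<Sum>k<L. tr_pow N w k * pair_pow N w K (L - 1 - k) + offdiag_part N w K k (L - 1 - k)) * tr_prod N w as
       + cross_sum N w K L as)"
    unfolding pair_deriv_sum[symmetric] cross_sum_def sum_distrib_right sum.distrib[symmetric]
    by (intro ext sum.cong refl) (simp only: distrib_left mult.assoc)
  finally show ?thesis .
qed

text \<open>The remainder r consists of the same-orientation pairings and the pairings with traces.
  Adding the nonnegative diagonal terms turns each of them into a genuine \<open>pair_pow\<close>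
  expression, so r is bounded by moments with fewer factors.\<close>

lemma moment_Suc:
  assumes \<sigma>: "\<sigma> > 0" and K: "\<And>i l. K i l \<ge> 0"
  obtains r where
    "moment N \<sigma> K (Suc L) as = \<sigma>\<^sup>2 * ((\<Sum>k<L. moment N \<sigma> K (L - 1 - k) (k # as)) + r)"
    "0 \<le> r" "r \<le> real L * moment N \<sigma> K (L - 1) as + wig_exp N \<sigma> (\<lambda>w. cross_bound N w K L as)"
proof -
  note st = nn_stat_closure nn_stat_pair_pow[OF K] nn_stat_offdiag_part[OF K] nn_stat_diag_part[OF K]
    nn_stat_tr_pow nn_stat_tr_prod nn_stat_cross_sum[OF K] nn_stat_cross_slack[OF K] nn_stat_sum
  let ?U = "\<lambda>k w. offdiag_part N w K k (L - 1 - k) * tr_prod N w as"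
  define r where "r = (\<Sum>k<L. wig_exp N \<sigma> (?U k)) + wig_exp N \<sigma> (\<lambda>w. cross_sum N w K L as)"
  have "wig_exp N \<sigma> (\<lambda>w.
     (\<Sum>k<L. tr_pow N w k * pair_pow N w K (L - 1 - k) + offdiag_part N w K k (L - 1 - k)) * tr_prod N w as
       + cross_sum N w K L as)
    = wig_exp N \<sigma> (\<lambda>w. (\<Sum>k<L. pair_pow N w K (L - 1 - k) * tr_prod N w (k # as) + ?U k w) + cross_sum N w K L as)"
    unfolding sum_distrib_right distrib_right tr_prod_simps by (simp only: mult_ac)
  also have "\<dots> = wig_exp N \<sigma> (\<lambda>w. \<Sum>k<L. pair_pow N w K (L - 1 - k) * tr_prod N w (k # as) + ?U k w)
      + wig_exp N \<sigma> (\<lambda>w. cross_sum N w K L as)"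
    by (rule wig_exp_add[OF \<sigma>]) (intro st)+
  also have "wig_exp N \<sigma> (\<lambda>w. \<Sum>k<L. pair_pow N w K (L - 1 - k) * tr_prod N w (k # as) + ?U k w)
     = (\<Sum>k<L. wig_exp N \<sigma> (\<lambda>w. pair_pow N w K (L - 1 - k) * tr_prod N w (k # as) + ?U k w))"
    by (rule wig_exp_sum[OF \<sigma>]) (intro st)+
  also have "\<dots> = (\<Sum>k<L. moment N \<sigma> K (L - 1 - k) (k # as) + wig_exp N \<sigma> (?U k))"
    unfolding moment_def by (intro sum.cong refl wig_exp_add[OF \<sigma>] st)
  finally have "moment N \<sigma> K (Suc L) as = \<sigma>\<^sup>2 * ((\<Sum>k<L. moment N \<sigma> K (L - 1 - k) (k # as)) + r)"
    unfolding moment_Suc_stein[OF \<sigma> K] r_def by (simp only: sum.distrib add.assoc)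
  moreover have "0 \<le> r"
    unfolding r_def by (intro add_nonneg_nonneg sum_nonneg wig_exp_nonneg[OF \<sigma>] st)
  moreover have "r \<le> real L * moment N \<sigma> K (L - 1) as + wig_exp N \<sigma> (\<lambda>w. cross_bound N w K L as)"
  proof -
    have "wig_exp N \<sigma> (?U k) \<le> moment N \<sigma> K (L - 1) as" if "k < L" for k
    proof -
      have "moment N \<sigma> K (L - 1) as = wig_exp N \<sigma> (\<lambda>w. ?U k w + diag_part N w K k (L - 1 - k) * tr_prod N w as)"
        unfolding moment_def
      proof (rule wig_exp_cong_sym)
        fix w :: "nat \<Rightarrow> nat \<Rightarrow> real" assume "\<And>i j. w i j = w j i"
        from offdiag_plus_diag[where N = N and K = K and k = k and m = "L - 1 - k", OF this] that
        show "pair_pow N w K (L - 1) * tr_prod N w as = ?U k w + diag_part N w K k (L - 1 - k) * tr_prod N w as"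
          by (simp add: distrib_right[symmetric])
      qed
      also have "\<dots> = wig_exp N \<sigma> (?U k) + wig_exp N \<sigma> (\<lambda>w. diag_part N w K k (L - 1 - k) * tr_prod N w as)"
        by (intro wig_exp_add[OF \<sigma>] st)
      also have "\<dots> \<ge> wig_exp N \<sigma> (?U k)"
        using wig_exp_nonneg[OF \<sigma>, of N "\<lambda>w. diag_part N w K k (L - 1 - k) * tr_prod N w as"] st by auto
      finally show ?thesis by simp
    qed
    then have "(\<Sum>k<L. wig_exp N \<sigma> (?U k)) \<le> real L * moment N \<sigma> K (L - 1) as"
      using sum_bounded_above[of "{..<L}" "\<lambda>k. wig_exp N \<sigma> (?U k)"] by simp
    moreover have "wig_exp N \<sigma> (\<lambda>w. cross_bound N w K L as)
      = wig_exp N \<sigma> (\<lambda>w. cross_sum N w K L as + cross_slack N w K L as)"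
      by (rule wig_exp_cong_sym) (rule cross_bound_eq)
    then have "wig_exp N \<sigma> (\<lambda>w. cross_bound N w K L as)
      = wig_exp N \<sigma> (\<lambda>w. cross_sum N w K L as) + wig_exp N \<sigma> (\<lambda>w. cross_slack N w K L as)"
      by (simp only: wig_exp_add[OF \<sigma> nn_stat_cross_sum[OF K] nn_stat_cross_slack[OF K]])
    then have "wig_exp N \<sigma> (\<lambda>w. cross_sum N w K L as) \<le> wig_exp N \<sigma> (\<lambda>w. cross_bound N w K L as)"
      using wig_exp_nonneg[OF \<sigma> nn_stat_cross_slack[OF K]] by simp
    ultimately show ?thesis unfolding r_def by (rule add_mono)
  qed
  ultimately show ?thesis by (rule that)
qed

section \<open>Catalan numbers\<close>

definition catalan :: "nat \<Rightarrow> real" where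
  "catalan n = real ((2 * n) choose n) / (real n + 1)"

lemma catalan_Suc: "(real n + 2) * catalan (Suc n) = (4 * real n + 2) * catalan n"
proof -
  have b: "real ((2 * m) choose m) = fact (2 * m) / (fact m * fact m)" for m
    using binomial_fact[of m "2 * m", where 'a = real] by (simp add: mult_2)
  have f: "fact (2 * Suc n) = (2 * real n + 2) * (2 * real n + 1) * (fact (2 * n) :: real)"
    by (simp add: algebra_simps)
  have "real ((2 * Suc n) choose (Suc n)) = (2 * real n + 2) * (2 * real n + 1) * fact (2 * n) / ((real n + 1) * (real n + 1) * (fact n * fact n))"
    unfolding b f by (simp add: algebra_simps)
  also have "\<dots> = (2 * (2 * real n + 1)) / (real n + 1) * real ((2 * n) choose n)"
  proof -
    have *: "(2 * r + 2) * x * y / ((r + 1) * (r + 1) * z) = (2 * x) / (r + 1) * (y / z)" if "r + 1 \<noteq> 0" for r x y z :: real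
    proof -
      have "(2 * r + 2) * x * y / ((r + 1) * (r + 1) * z) = ((r + 1) * (2 * x * y)) / ((r + 1) * ((r + 1) * z))"
        by (simp add: algebra_simps)
      then show ?thesis using that by simp
    qed
    show ?thesis unfolding b by (rule *) (metis add.commute of_nat_Suc of_nat_neq_0)
  qed
  finally have 1: "real ((2 * Suc n) choose (Suc n)) = (2 * (2 * real n + 1)) / (real n + 1) * real ((2 * n) choose n)" .
  have 2: "(r + 2) * ((2 * (2 * r + 1)) / (r + 1) * b / (r + 2)) = (4 * r + 2) * (b / (r + 1))" if "r \<ge> 0" for r b :: real
  proof -
    have "(r + 2) * (y / (r + 2)) = y" for y using that by simp
    moreover have "(2 * (2 * r + 1)) / (r + 1) * b = (4 * r + 2) * (b / (r + 1))" by simp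
    ultimately show ?thesis by simp
  qed
  have 3: "real (Suc n) + 1 = real n + 2" by simp
  show ?thesis unfolding catalan_def 1 3 by (rule 2) simp
qed

text \<open>These are the coefficients of sqrt(1 - 4 x) = 1 - 2 x C(x), with C the Catalan
  generating function. Both sides obey the same first-order recurrence.\<close>

lemma catalan_gbinomial: "((1 / 2 :: real) gchoose Suc n) * (- 4) ^ Suc n = - 2 * catalan n"
proof (induction n)
  case 0
  then show ?case by (simp add: catalan_def)
next
  case (Suc n)
  have "(1 / 2) * ((1 / 2 :: real) gchoose Suc n) = of_nat (Suc n) * ((1 / 2) gchoose Suc n)
      + of_nat (Suc (Suc n)) * ((1 / 2) gchoose Suc (Suc n))"
    by (rule gbinomial_mult_1)
  then have h: "(real n + 2) * ((1 / 2 :: real) gchoose Suc (Suc n)) = (- 1 / 2 - real n) * ((1 / 2) gchoose Suc n)"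
    by (simp add: algebra_simps)
  have "(real n + 2) * (((1 / 2 :: real) gchoose Suc (Suc n)) * (- 4) ^ Suc (Suc n))
     = ((real n + 2) * ((1 / 2) gchoose Suc (Suc n))) * (- 4) * (- 4) ^ Suc n"
    by simp
  also have "\<dots> = (4 * real n + 2) * (((1 / 2) gchoose Suc n) * (- 4) ^ Suc n)"
    unfolding h by (simp add: algebra_simps)
  also have "(4 * real n + 2) * (((1 / 2) gchoose Suc n) * (- 4) ^ Suc n) = - 2 * ((4 * real n + 2) * catalan n)" unfolding Suc.IH by simp
  also have "\<dots> = (real n + 2) * (- 2 * catalan (Suc n))" unfolding catalan_Suc[symmetric] by simp
  finally show ?case by (simp only: mult_cancel_left) (use of_nat_0_le_iff[of n, where 'a = real] in linarith)
qed

text \<open>With \<open>G k = binom (1/2) k (- 4)^k\<close>, Vandermonde's identity says that the convolution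
  square of \<open>G\<close> is \<open>binom 1 n (- 4)^n\<close>, which vanishes for \<open>n \<ge> 2\<close>.\<close>
lemma catalan_convolution: "catalan (Suc n) = (\<Sum>k\<le>n. catalan k * catalan (n - k))"
proof -
  define G where "G k = ((1 / 2 :: real) gchoose k) * (- 4) ^ k" for k
  have G: "G (Suc k) = - 2 * catalan k" for k
    unfolding G_def by (rule catalan_gbinomial)
  have "(\<Sum>k=0..Suc (Suc n). ((1 / 2 :: real) gchoose k) * ((1 / 2) gchoose (Suc (Suc n) - k))) = 1 gchoose Suc (Suc n)"
    using gbinomial_Vandermonde[of "1 / 2 :: real" "1 / 2" "Suc (Suc n)"] by simp
  also have "(1 :: real) gchoose Suc (Suc n) = 0"
    using binomial_gbinomial[of 1 "Suc (Suc n)", where 'a = real] by simp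
  finally have "(\<Sum>k=0..Suc (Suc n). ((1 / 2 :: real) gchoose k) * ((1 / 2) gchoose (Suc (Suc n) - k))) * (- 4) ^ Suc (Suc n) = 0"
    by simp
  also have "(\<Sum>k=0..Suc (Suc n). ((1 / 2 :: real) gchoose k) * ((1 / 2) gchoose (Suc (Suc n) - k))) * (- 4) ^ Suc (Suc n)
    = (\<Sum>k=0..Suc (Suc n). G k * G (Suc (Suc n) - k))"
    unfolding sum_distrib_right
  proof (intro sum.cong refl)
    fix k assume "k \<in> {0..Suc (Suc n)}"
    then have "(- 4 :: real) ^ Suc (Suc n) = (- 4) ^ k * (- 4) ^ (Suc (Suc n) - k)"
      by (subst power_add[symmetric]) simp
    then show "((1 / 2 :: real) gchoose k) * ((1 / 2) gchoose (Suc (Suc n) - k)) * (- 4) ^ Suc (Suc n) = G k * G (Suc (Suc n) - k)"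
      unfolding G_def by (simp only: mult_ac)
  qed
  \<comment> \<open>The two ends of the sum carry G 0 = 1 and each equal - 2
    \<open>catalan (Suc n)\<close>; the middle part is 4 times the wanted convolution.\<close>
  also have "\<dots> = G 0 * G (Suc (Suc n)) + (\<Sum>k=0..n. G (Suc k) * G (Suc n - k)) + G (Suc (Suc n)) * G 0"
    by (subst sum.atLeast0_atMost_Suc, subst sum.atLeast0_atMost_Suc_shift) simp
  also have "(\<Sum>k=0..n. G (Suc k) * G (Suc n - k)) = 4 * (\<Sum>k=0..n. catalan k * catalan (n - k))"
    unfolding sum_distrib_left by (intro sum.cong refl) (simp add: G Suc_diff_le)
  finally show ?thesis
    by (simp add: G G_def[of 0] atLeast0AtMost)
qed

text \<open>Moments of the semicircle law of variance 1.\<close>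

definition semicircle_moment :: "nat \<Rightarrow> real" where
  "semicircle_moment n = (if odd n then 0 else catalan (n div 2))"

text \<open>For even L the indices k and L - 1 - k have an odd sum, so one factor vanishes; for odd
  L only even k survive, and the sum is the Catalan convolution.\<close>

lemma semicircle_moment_Suc:
  "semicircle_moment (Suc L) = (\<Sum>k<L. semicircle_moment k * semicircle_moment (L - 1 - k))"
proof (cases "even L")
  case True
  have "semicircle_moment k * semicircle_moment (L - 1 - k) = 0" if "k < L" for k
  proof (cases "odd k")
    case False
    then have "odd (L - 1 - k)" using True that by auto
    then show ?thesis by (simp add: semicircle_moment_def)
  qed (simp add: semicircle_moment_def)
  then have "(\<Sum>k<L. semicircle_moment k * semicircle_moment (L - 1 - k)) = 0" by (intro sum.neutral) auto
  with True show ?thesis by (simp add: semicircle_moment_def)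
next
  case False
  then obtain n where L: "L = 2 * n + 1" by (elim oddE)
  let ?g = "\<lambda>k. semicircle_moment k * semicircle_moment (L - 1 - k)"
  have even_sum: "(\<Sum>k<2 * m + 1. g k) = (\<Sum>k\<le>m. g (2 * k))" if "\<And>k. odd k \<Longrightarrow> g k = 0" for m and g :: "nat \<Rightarrow> real"
    using that by (induction m) auto
  have "(\<Sum>k<L. ?g k) = (\<Sum>k\<le>n. ?g (2 * k))"
    unfolding L by (rule even_sum) (simp add: semicircle_moment_def)
  also have "\<dots> = (\<Sum>k\<le>n. catalan k * catalan (n - k))"
    unfolding L by (intro sum.cong refl) (auto simp: semicircle_moment_def diff_mult_distrib2[symmetric])
  also have "\<dots> = semicircle_moment (Suc L)"
    unfolding L catalan_convolution[symmetric] by (simp add: semicircle_moment_def)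
  finally show ?thesis by simp
qed

section \<open>Limits of normalised moments\<close>

text \<open>\<open>bs\<close> holds the traces already passed, so that every term is the moment with
  exactly one trace removed from the list and merged into the walk.\<close>

fun cross_exp :: "nat \<Rightarrow> real \<Rightarrow> (nat \<Rightarrow> nat \<Rightarrow> real) \<Rightarrow> nat \<Rightarrow> nat list \<Rightarrow> nat list \<Rightarrow> real" where
  "cross_exp N \<sigma> K L bs [] = 0"
| "cross_exp N \<sigma> K L bs (a # as) =
     2 * real a * moment N \<sigma> K (L + a - 1) (bs @ as) + cross_exp N \<sigma> K L (bs @ [a]) as"

lemma wig_exp_cross_bound:
  assumes \<sigma>: "\<sigma> > 0" and K: "\<And>i l. K i l \<ge> 0"
  shows "wig_exp N \<sigma> (\<lambda>w. tr_prod N w bs * cross_bound N w K L as) = cross_exp N \<sigma> K L bs as"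
proof (induction as arbitrary: bs)
  case Nil
  then show ?case by (simp add: wig_exp_def)
next
  case (Cons a as)
  note st = nn_stat_closure nn_stat_pair_pow[OF K] nn_stat_tr_pow nn_stat_tr_prod nn_stat_cross_bound[OF K]
  have "wig_exp N \<sigma> (\<lambda>w. tr_prod N w bs * cross_bound N w K L (a # as)) =
    wig_exp N \<sigma> (\<lambda>w. 2 * real a * (pair_pow N w K (L + a - 1) * tr_prod N w (bs @ as))
      + tr_prod N w (bs @ [a]) * cross_bound N w K L as)"
    unfolding cross_bound.simps tr_prod_simps distrib_left mult_1_right by (simp only: mult_ac)
  also have "\<dots> = wig_exp N \<sigma> (\<lambda>w. 2 * real a * (pair_pow N w K (L + a - 1) * tr_prod N w (bs @ as)))
      + wig_exp N \<sigma> (\<lambda>w. tr_prod N w (bs @ [a]) * cross_bound N w K L as)"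
    by (rule wig_exp_add[OF \<sigma>]) (intro st mult_nonneg_nonneg of_nat_0_le_iff zero_le_numeral)+
  also have "\<dots> = cross_exp N \<sigma> K L bs (a # as)"
    unfolding wig_exp_cmult Cons.IH by (simp add: moment_def)
  finally show ?case .
qed

text \<open>The walk and each trace count a factor N, and each matrix factor counts \<sigma> sqrt N,
  the scale of the spectrum.\<close>

definition norm_moment :: "nat \<Rightarrow> real \<Rightarrow> (nat \<Rightarrow> nat \<Rightarrow> real) \<Rightarrow> nat \<Rightarrow> nat list \<Rightarrow> real" where
  "norm_moment N \<sigma> K L as =
     moment N \<sigma> K L as / (real N ^ (1 + length as) * (\<sigma> * sqrt (real N)) ^ (L + sum_list as))"

text \<open>Integration by parts trades two matrix factors for \<sigma>^2, which is (\<sigma> sqrt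
  N)^2 / N. The lost N is regained exactly when a new trace appears.\<close>

lemma normalise_step:
  assumes "N > 0" "\<sigma> > 0" "q' = q + 2"
  shows "\<sigma>\<^sup>2 * m / (real N ^ p * (\<sigma> * sqrt (real N)) ^ q') = m / (real N ^ Suc p * (\<sigma> * sqrt (real N)) ^ q)"
proof -
  have "(\<sigma> * sqrt (real N)) ^ q' = (\<sigma> * sqrt (real N)) ^ q * (\<sigma>\<^sup>2 * real N)"
    by (simp add: assms(3) power_add power2_eq_square algebra_simps)
  then have "\<sigma>\<^sup>2 * m / (real N ^ p * (\<sigma> * sqrt (real N)) ^ q') = \<sigma>\<^sup>2 * m / (\<sigma>\<^sup>2 * (real N ^ Suc p * (\<sigma> * sqrt (real N)) ^ q))"
    by (simp only: power_Suc mult_ac)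
  then show ?thesis using assms by simp
qed

text \<open>A trace merged into the walk takes its factor N with it and integration by parts costs
  another, so each term is a convergent sequence divided by N^2. Convergence is asked for a > 0
  only, as the trace of the zeroth power is constant.\<close>

lemma norm_cross_exp_tendsto:
  assumes \<sigma>: "\<And>N. N > 0 \<Longrightarrow> \<sigma> N > 0"
    and conv: "\<And>bs' a as'. bs @ as = bs' @ a # as' \<Longrightarrow> a > 0 \<Longrightarrow>
      convergent (\<lambda>N. norm_moment N (\<sigma> N) K (L + a - 1) (bs' @ as'))"
  shows "(\<lambda>N. (\<sigma> N)\<^sup>2 * cross_exp N (\<sigma> N) K L bs as /
      (real N ^ (1 + length bs + length as) * (\<sigma> N * sqrt (real N)) ^ (Suc L + sum_list bs + sum_list as))) \<longlonglongrightarrow> 0"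
  using conv
proof (induction as arbitrary: bs)
  case Nil
  then show ?case by simp
next
  case (Cons a as)
  let ?D = "\<lambda>N. real N ^ (1 + length bs + length (a # as)) * (\<sigma> N * sqrt (real N)) ^ (Suc L + sum_list bs + sum_list (a # as))"
  have "(\<lambda>N. (\<sigma> N)\<^sup>2 * cross_exp N (\<sigma> N) K L (bs @ [a]) as /
      (real N ^ (1 + length (bs @ [a]) + length as) * (\<sigma> N * sqrt (real N)) ^ (Suc L + sum_list (bs @ [a]) + sum_list as))) \<longlonglongrightarrow> 0"
  proof (rule Cons.IH)
    fix bs' a' as' assume "(bs @ [a]) @ as = bs' @ a' # as'" "0 < a'"
    then show "convergent (\<lambda>N. norm_moment N (\<sigma> N) K (L + a' - 1) (bs' @ as'))"
      using Cons.prems[of bs' a' as'] by simp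
  qed
  then have 2: "(\<lambda>N. (\<sigma> N)\<^sup>2 * cross_exp N (\<sigma> N) K L (bs @ [a]) as / ?D N) \<longlonglongrightarrow> 0"
    by (simp add: add.assoc add_ac)
  have 1: "(\<lambda>N. (\<sigma> N)\<^sup>2 * (2 * real a * moment N (\<sigma> N) K (L + a - 1) (bs @ as)) / ?D N) \<longlonglongrightarrow> 0"
  proof (cases "a = 0")
    case False
    obtain l where l: "(\<lambda>N. norm_moment N (\<sigma> N) K (L + a - 1) (bs @ as)) \<longlonglongrightarrow> l"
      using Cons.prems[of bs a as] False by (auto simp: convergent_def)
    have "(\<lambda>N. 2 * real a * norm_moment N (\<sigma> N) K (L + a - 1) (bs @ as) * (1 / real N) * (1 / real N)) \<longlonglongrightarrow> 2 * real a * l * 0 * 0"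
      by (intro tendsto_intros l lim_1_over_n)
    moreover have "eventually (\<lambda>N. 2 * real a * norm_moment N (\<sigma> N) K (L + a - 1) (bs @ as) * (1 / real N) * (1 / real N)
       = (\<sigma> N)\<^sup>2 * (2 * real a * moment N (\<sigma> N) K (L + a - 1) (bs @ as)) / ?D N) sequentially"
      using eventually_gt_at_top[of 0]
    proof eventually_elim
      case (elim N)
      have "(\<sigma> N)\<^sup>2 * (2 * real a * moment N (\<sigma> N) K (L + a - 1) (bs @ as)) / ?D N
        = 2 * real a * moment N (\<sigma> N) K (L + a - 1) (bs @ as) /
          (real N ^ Suc (1 + length bs + length (a # as)) * (\<sigma> N * sqrt (real N)) ^ (L + a - 1 + sum_list (bs @ as)))"
        using False by (intro normalise_step elim \<sigma>) auto
      then show ?case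
        by (simp add: norm_moment_def)
    qed
    ultimately show ?thesis by (simp add: tendsto_cong)
  qed simp
  have "(\<lambda>N. (\<sigma> N)\<^sup>2 * (2 * real a * moment N (\<sigma> N) K (L + a - 1) (bs @ as)) / ?D N
      + (\<sigma> N)\<^sup>2 * cross_exp N (\<sigma> N) K L (bs @ [a]) as / ?D N) \<longlonglongrightarrow> 0 + 0"
    by (intro tendsto_add 1 2)
  then show ?case by (simp only: add_divide_distrib[symmetric] distrib_left[symmetric] cross_exp.simps add_0_left)
qed

text \<open>The leading term of the recursion lowers the total degree by 2 and adds one trace, so
  the measure drops by 3. At L = 0 the walk is the constant N and the first trace takes over its
  role, with the identity as new \<open>K\<close> and one trace fewer; this is why \<open>K\<close>
  varies in the induction, normalised to 1 on the diagonal.\<close>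

lemma norm_moment_tendsto:
  assumes \<sigma>: "\<And>N. N > 0 \<Longrightarrow> \<sigma> N > 0" and K: "\<And>i l. K i l \<ge> 0" "\<And>i. K i i = 1"
  shows "(\<lambda>N. norm_moment N (\<sigma> N) K L as) \<longlonglongrightarrow> semicircle_moment L * (\<Prod>a\<leftarrow>as. semicircle_moment a)"
  using K
proof (induction "2 * (L + sum_list as) + length as" arbitrary: L as K rule: less_induct)
  case less
  note K = less.prems
  show ?case
  proof (cases L)
    case 0
    have p0: "pair_pow N w K 0 = real N" for N w
    proof -
      have "pair_pow N w K 0 = (\<Sum>i<N. \<Sum>l<N. if i = l then K i l else 0)"
        unfolding pair_pow_def by (intro sum.cong) auto
      also have "\<dots> = real N" by (simp add: K(2))
      finally show ?thesis .
    qed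
    have sc0: "semicircle_moment 0 = 1" by (simp add: semicircle_moment_def catalan_def)
    show ?thesis
    proof (cases as)
      case Nil
      have "eventually (\<lambda>N. 1 = norm_moment N (\<sigma> N) K L as) sequentially"
        using eventually_gt_at_top[of 0]
      proof eventually_elim
        case (elim N)
        then show ?case by (simp add: norm_moment_def moment_def 0 Nil p0 wig_exp_const[OF \<sigma>])
      qed
      then have "(\<lambda>N. norm_moment N (\<sigma> N) K L as) \<longlonglongrightarrow> 1"
        by (rule Lim_transform_eventually[OF tendsto_const])
      then show ?thesis by (simp add: 0 Nil sc0)
    next
      case (Cons a as')
      let ?I = "\<lambda>i l :: nat. if i = l then 1 else 0 :: real"
      have "(\<lambda>N. norm_moment N (\<sigma> N) ?I a as') \<longlonglongrightarrow> semicircle_moment a * (\<Prod>a\<leftarrow>as'. semicircle_moment a)"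
        by (rule less.hyps) (auto simp: 0 Cons)
      moreover have "eventually (\<lambda>N. norm_moment N (\<sigma> N) ?I a as' = norm_moment N (\<sigma> N) K L as) sequentially"
        using eventually_gt_at_top[of 0]
      proof eventually_elim
        case (elim N)
        have "pair_pow N w ?I a = tr_pow N w a" for w
        proof -
          have "pair_pow N w ?I a = (\<Sum>i<N. \<Sum>l<N. if i = l then walk_sum N w a i l else 0)"
            unfolding pair_pow_def by (intro sum.cong) auto
          then show ?thesis by (simp add: tr_pow_def)
        qed
        then have "moment N (\<sigma> N) K L as = real N * moment N (\<sigma> N) ?I a as'"
          by (simp add: moment_def 0 Cons p0 wig_exp_cmult)
        then show ?case using elim by (simp add: norm_moment_def 0 Cons)
      qed
      ultimately show ?thesis using Lim_transform_eventually by (auto simp: 0 Cons sc0)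
    qed
  next
    case (Suc M)
    have IH: "(\<lambda>N. norm_moment N (\<sigma> N) K L' as') \<longlonglongrightarrow> semicircle_moment L' * (\<Prod>a\<leftarrow>as'. semicircle_moment a)"
      if "2 * (L' + sum_list as') + length as' < 2 * (L + sum_list as) + length as" for L' as'
      using less.hyps[OF that K] .
    let ?D = "\<lambda>N. real N ^ (1 + length as) * (\<sigma> N * sqrt (real N)) ^ (Suc M + sum_list as)"
    let ?P = "\<Prod>a\<leftarrow>as. semicircle_moment a"
    define main where "main N = (\<Sum>k<M. norm_moment N (\<sigma> N) K (M - 1 - k) (k # as))" for N
    \<comment> \<open>The two kinds of lower-order terms after normalisation: same-orientation
      pairings create no trace and lose 1 / N; pairings with traces vanish by
      \<open>norm_cross_exp_tendsto\<close>.\<close>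
    define err where "err N = real M * norm_moment N (\<sigma> N) K (M - 1) as * (1 / real N)
       + (\<sigma> N)\<^sup>2 * cross_exp N (\<sigma> N) K M [] as / ?D N" for N
    have main: "main \<longlonglongrightarrow> semicircle_moment L * ?P"
    proof -
      have "main \<longlonglongrightarrow> (\<Sum>k<M. semicircle_moment (M - 1 - k) * (\<Prod>a\<leftarrow>k # as. semicircle_moment a))"
        unfolding main_def by (intro tendsto_sum IH) (auto simp: Suc)
      also have "(\<Sum>k<M. semicircle_moment (M - 1 - k) * (\<Prod>a\<leftarrow>k # as. semicircle_moment a)) = semicircle_moment L * ?P"
        unfolding Suc semicircle_moment_Suc sum_distrib_right by (intro sum.cong refl) simp
      finally show ?thesis .
    qed
    have err: "err \<longlonglongrightarrow> 0"
    proof -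
      have "(\<lambda>N. real M * norm_moment N (\<sigma> N) K (M - 1) as * (1 / real N)) \<longlonglongrightarrow> real M * (semicircle_moment (M - 1) * ?P) * 0"
        by (intro tendsto_intros IH lim_1_over_n) (auto simp: Suc)
      moreover have "(\<lambda>N. (\<sigma> N)\<^sup>2 * cross_exp N (\<sigma> N) K M [] as /
         (real N ^ (1 + length ([] :: nat list) + length as) * (\<sigma> N * sqrt (real N)) ^ (Suc M + sum_list [] + sum_list as))) \<longlonglongrightarrow> 0"
      proof (rule norm_cross_exp_tendsto[OF \<sigma>])
        fix bs' a as' assume eq: "[] @ as = bs' @ a # as'" and a: "a > 0"
        show "convergent (\<lambda>N. norm_moment N (\<sigma> N) K (M + a - 1) (bs' @ as'))"
          using eq a by (intro convergentI[OF IH]) (auto simp: Suc)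
      qed
      then have "(\<lambda>N. (\<sigma> N)\<^sup>2 * cross_exp N (\<sigma> N) K M [] as / ?D N) \<longlonglongrightarrow> 0" by simp
      ultimately show ?thesis unfolding err_def using tendsto_add by fastforce
    qed
    have bnd: "0 \<le> norm_moment N (\<sigma> N) K L as - main N \<and> norm_moment N (\<sigma> N) K L as - main N \<le> err N" if N: "N > 0" for N
    proof -
      note \<sigma>N = \<sigma>[OF N]
      obtain r where r: "moment N (\<sigma> N) K (Suc M) as = (\<sigma> N)\<^sup>2 * ((\<Sum>k<M. moment N (\<sigma> N) K (M - 1 - k) (k # as)) + r)"
        "0 \<le> r" "r \<le> real M * moment N (\<sigma> N) K (M - 1) as + wig_exp N (\<sigma> N) (\<lambda>w. cross_bound N w K M as)"
        using moment_Suc[OF \<sigma>N K(1)] .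
      have D: "?D N > 0" using N \<sigma>N by simp
      have "norm_moment N (\<sigma> N) K L as = (\<Sum>k<M. (\<sigma> N)\<^sup>2 * moment N (\<sigma> N) K (M - 1 - k) (k # as) / ?D N) + (\<sigma> N)\<^sup>2 * r / ?D N"
        unfolding norm_moment_def Suc r(1) distrib_left sum_distrib_left add_divide_distrib sum_divide_distrib ..
      also have "(\<Sum>k<M. (\<sigma> N)\<^sup>2 * moment N (\<sigma> N) K (M - 1 - k) (k # as) / ?D N) = main N"
        unfolding main_def norm_moment_def
      proof (intro sum.cong refl)
        fix k assume k: "k \<in> {..<M}"
        then show "(\<sigma> N)\<^sup>2 * moment N (\<sigma> N) K (M - 1 - k) (k # as) / ?D N = moment N (\<sigma> N) K (M - 1 - k) (k # as)
          / (real N ^ (1 + length (k # as)) * (\<sigma> N * sqrt (real N)) ^ (M - 1 - k + sum_list (k # as)))"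
          using normalise_step[OF N \<sigma>N, where q' = "Suc M + sum_list as" and q = "M - 1 - k + sum_list (k # as)"
            and p = "1 + length as" and m = "moment N (\<sigma> N) K (M - 1 - k) (k # as)"] by simp
      qed
      finally have diff: "norm_moment N (\<sigma> N) K L as - main N = (\<sigma> N)\<^sup>2 * r / ?D N" by simp
      have "wig_exp N (\<sigma> N) (\<lambda>w. cross_bound N w K M as) = cross_exp N (\<sigma> N) K M [] as"
        using wig_exp_cross_bound[OF \<sigma>N K(1), of N "[]"] by simp
      then have "(\<sigma> N)\<^sup>2 * r / ?D N \<le> (\<sigma> N)\<^sup>2 * (real M * moment N (\<sigma> N) K (M - 1) as + cross_exp N (\<sigma> N) K M [] as) / ?D N"
        using r(3) D by (intro divide_right_mono mult_left_mono) auto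
      also have "\<dots> = (\<sigma> N)\<^sup>2 * (real M * moment N (\<sigma> N) K (M - 1) as) / ?D N + (\<sigma> N)\<^sup>2 * cross_exp N (\<sigma> N) K M [] as / ?D N"
        unfolding distrib_left add_divide_distrib ..
      also have "(\<sigma> N)\<^sup>2 * (real M * moment N (\<sigma> N) K (M - 1) as) / ?D N = real M * norm_moment N (\<sigma> N) K (M - 1) as * (1 / real N)"
      proof (cases "M = 0")
        case False
        then have "(\<sigma> N)\<^sup>2 * (real M * moment N (\<sigma> N) K (M - 1) as) / ?D N = real M * moment N (\<sigma> N) K (M - 1) as /
          (real N ^ Suc (1 + length as) * (\<sigma> N * sqrt (real N)) ^ (M - 1 + sum_list as))"
          by (intro normalise_step[OF N \<sigma>N]) simp
        then show ?thesis by (simp add: norm_moment_def)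
      qed simp
      finally have "(\<sigma> N)\<^sup>2 * r / ?D N \<le> err N" by (simp only: err_def)
      then show ?thesis unfolding diff using r(2) D by simp
    qed
    have "(\<lambda>N. norm_moment N (\<sigma> N) K L as - main N) \<longlonglongrightarrow> 0"
    proof (rule tendsto_sandwich[OF _ _ tendsto_const err])
      show "eventually (\<lambda>N. 0 \<le> norm_moment N (\<sigma> N) K L as - main N) sequentially"
        "eventually (\<lambda>N. norm_moment N (\<sigma> N) K L as - main N \<le> err N) sequentially"
        using eventually_gt_at_top[of 0] by (eventually_elim, use bnd in blast)+
    qed
    from tendsto_add[OF this main] show ?thesis by simp
  qed
qed

section \<open>Path sums as matrix powers\<close>

lemma sum_paths_walk_sum:
  assumes i: "i < N"
  shows "(\<Sum>p \<in> {p \<in> {..l} \<rightarrow>\<^sub>E {..<N}. p 0 = i}. (\<Prod>k<l. W (p k) (p (Suc k))) * h (p l))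
    = (\<Sum>j<N. walk_sum N W l i j * h j)"
proof (induction l arbitrary: h)
  case 0
  have "{p \<in> {..0::nat} \<rightarrow>\<^sub>E {..<N}. p 0 = i} = {\<lambda>x. if x = 0 then i else undefined}"
    using i by (auto simp: PiE_iff extensional_def)
  moreover have "(\<Sum>j<N. walk_sum N W 0 i j * h j) = (\<Sum>j<N. if i = j then h j else 0)"
    by (intro sum.cong) auto
  ultimately show ?case using i by simp
next
  \<comment> \<open>Paths grow at their end whereas \<open>walk_sum\<close> unfolds at its start;
    the arbitrary terminal weight \<open>h\<close> absorbs the last step.\<close>
  case (Suc l)
  let ?A = "\<lambda>l. {p \<in> {..l} \<rightarrow>\<^sub>E {..<N}. p 0 = i}"
  let ?f = "\<lambda>(p, j). p(Suc l := j)"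
  have A: "?A (Suc l) = ?f ` (?A l \<times> {..<N})"
  proof (intro equalityI subsetI)
    fix p assume p: "p \<in> ?A (Suc l)"
    have "p = ?f (p(Suc l := undefined), p (Suc l))" by simp
    moreover have "p(Suc l := undefined) \<in> ?A l" "p (Suc l) \<in> {..<N}"
      using p by (auto simp: PiE_iff extensional_def)
    ultimately show "p \<in> ?f ` (?A l \<times> {..<N})" by (metis (no_types, lifting) SigmaI image_eqI)
  next
    fix p assume "p \<in> ?f ` (?A l \<times> {..<N})"
    then show "p \<in> ?A (Suc l)" by (auto simp: PiE_iff extensional_def)
  qed
  \<comment> \<open>Extensionality makes this injective: both paths are \<open>undefined\<close> at
    \<open>Suc l\<close> before the update.\<close>
  have inj: "inj_on ?f (?A l \<times> {..<N})"
  proof (rule inj_onI, clarify)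
    fix p j q k assume p: "p \<in> {..l} \<rightarrow>\<^sub>E {..<N}" and q: "q \<in> {..l} \<rightarrow>\<^sub>E {..<N}"
      and eq: "p(Suc l := j) = q(Suc l := k)"
    have "p x = q x" for x
    proof (cases "x = Suc l")
      case True
      then show ?thesis using p q by (simp add: PiE_iff extensional_def)
    next
      case False
      then show ?thesis using fun_cong[OF eq, of x] by simp
    qed
    then show "p = q \<and> j = k" using fun_cong[OF eq, of "Suc l"] by auto
  qed
  have "(\<Sum>p \<in> ?A (Suc l). (\<Prod>k<Suc l. W (p k) (p (Suc k))) * h (p (Suc l)))
    = (\<Sum>(p, j) \<in> ?A l \<times> {..<N}. (\<Prod>k<l. W (p k) (p (Suc k))) * (W (p l) j * h j))"
    unfolding A sum.reindex[OF inj] by (intro sum.cong refl) (auto simp: mult.assoc)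
  also have "\<dots> = (\<Sum>p \<in> ?A l. (\<Prod>k<l. W (p k) (p (Suc k))) * (\<Sum>j<N. W (p l) j * h j))"
    unfolding sum_distrib_left sum.cartesian_product ..
  also have "\<dots> = (\<Sum>x<N. walk_sum N W l i x * (\<Sum>j<N. W x j * h j))"
    by (rule Suc.IH)
  also have "\<dots> = (\<Sum>x<N. \<Sum>j<N. walk_sum N W l i x * W x j * h j)"
    by (simp only: sum_distrib_left mult.assoc)
  also have "\<dots> = (\<Sum>j<N. \<Sum>x<N. walk_sum N W l i x * W x j * h j)"
    by (rule sum.swap)
  also have "\<dots> = (\<Sum>j<N. walk_sum N W (l + Suc 0) i j * h j)"
    unfolding walk_sum_add[OF i] sum_distrib_right
    by (intro sum.cong refl) (simp only: walk_sum_one lessThan_iff)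
  finally show ?case by simp
qed

lemma gm_beta_walk_sum:
  "i < N \<Longrightarrow> gm_beta N W i l = (\<Sum>j<N. walk_sum N W l i j)"
  using sum_paths_walk_sum[where h = "\<lambda>_. 1"] by (simp add: gm_beta_def)

text \<open>Both walks start at i; reversing the first and concatenating at i gives one walk of
  length l1 + l2. Hence the moment matrix has Hankel form.\<close>

lemma sum_gm_beta_pair_pow:
  assumes sym: "\<And>i j. w i j = w j i"
  shows "(\<Sum>i<N. gm_beta N w i l1 * gm_beta N w i l2) = pair_pow N w (\<lambda>_ _. 1) (l1 + l2)"
proof -
  let ?p = "walk_sum N w"
  have "(\<Sum>i<N. gm_beta N w i l1 * gm_beta N w i l2) = (\<Sum>i<N. \<Sum>j<N. \<Sum>l<N. ?p l1 i j * ?p l2 i l)"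
    by (intro sum.cong refl) (simp add: gm_beta_walk_sum sum_product)
  also have "\<dots> = (\<Sum>j<N. \<Sum>i<N. \<Sum>l<N. ?p l1 i j * ?p l2 i l)" by (rule sum.swap)
  also have "\<dots> = (\<Sum>j<N. \<Sum>l<N. \<Sum>i<N. ?p l1 i j * ?p l2 i l)"
    by (rule sum.cong[OF refl]) (rule sum.swap)
  also have "\<dots> = (\<Sum>j<N. \<Sum>l<N. 1 * ?p (l1 + l2) j l)"
  proof (intro sum.cong refl)
    fix j l assume "j \<in> {..<N}"
    then have j: "j < N" by simp
    show "(\<Sum>i<N. ?p l1 i j * ?p l2 i l) = 1 * ?p (l1 + l2) j l"
      unfolding walk_sum_add[OF j] mult_1
      using walk_sum_sym[where n = l1 and N = N and w = w, OF sym j] by (intro sum.cong) auto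
  qed
  finally show ?thesis by (simp only: pair_pow_def)
qed

lemma gen_moment_matrix_entry:
  assumes "l1 \<le> T" "l2 \<le> T"
  shows "gen_moment_matrix \<rho> \<alpha> T N $$ (l1, l2) = moment N (\<rho> / real N powr \<alpha>) (\<lambda>_ _. 1) (l1 + l2) []"
  using assms
  by (simp add: gen_moment_matrix_def moment_def wig_exp_def wigner_measure_def
      sum_gm_beta_pair_pow[OF sym_entry_commute])


section \<open>Spectrum of the generalised moment matrix\<close>

lemma gen_moment_matrix_carrier: "gen_moment_matrix \<rho> \<alpha> T N \<in> carrier_mat (T + 1) (T + 1)"
  by (simp add: gen_moment_matrix_def)

lemma gen_moment_matrix_symmetric: "transpose_mat (gen_moment_matrix \<rho> \<alpha> T N) = gen_moment_matrix \<rho> \<alpha> T N"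
  by (rule eq_matI) (auto simp: gen_moment_matrix_def mult.commute)

lemma A_sc_carrier: "A_sc \<rho> T \<in> carrier_mat (T + 1) (T + 1)"
  by (simp add: A_sc_def)

lemma A_sc_symmetric: "transpose_mat (A_sc \<rho> T) = A_sc \<rho> T"
  by (rule eq_matI) (auto simp: A_sc_def add.commute)

lemma A_sc_entry:
  assumes "l1 \<le> T" "l2 \<le> T"
  shows "A_sc \<rho> T $$ (l1, l2) = \<rho> ^ (l1 + l2) * semicircle_moment (l1 + l2)"
proof (cases "odd (l1 + l2)")
  case False
  then have "2 * ((l1 + l2) div 2) = l1 + l2" by simp
  with False assms show ?thesis
    by (simp add: A_sc_def semicircle_moment_def catalan_def)
qed (use assms in \<open>simp add: A_sc_def semicircle_moment_def\<close>)

text \<open>The walk contributes one N and each of its l1 + l2 factors the scale \<sigma> sqrt N =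
  \<rho> N^(1/2 - \<alpha>), so \<alpha> influences the order of growth through the exponent
  alone.\<close>

lemma gen_moment_matrix_entry_asymp:
  assumes "\<rho> > 0" "l1 \<le> T" "l2 \<le> T"
  obtains x where "x \<longlonglongrightarrow> semicircle_moment (l1 + l2)"
    "\<And>N. N > 0 \<Longrightarrow> gen_moment_matrix \<rho> \<alpha> T N $$ (l1, l2) =
       x N * \<rho> ^ (l1 + l2) * real N powr (1 + real (l1 + l2) * (1 / 2 - \<alpha>))"
proof -
  define \<sigma> where "\<sigma> N = \<rho> / real N powr \<alpha>" for N
  have \<sigma>: "\<sigma> N > 0" if "N > 0" for N using that assms by (simp add: \<sigma>_def)
  define x where "x N = norm_moment N (\<sigma> N) (\<lambda>_ _. 1) (l1 + l2) []" for N
  have "x \<longlonglongrightarrow> semicircle_moment (l1 + l2) * (\<Prod>a\<leftarrow>[]. semicircle_moment a)"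
    unfolding x_def by (rule norm_moment_tendsto) (auto intro: \<sigma>)
  then have lim: "x \<longlonglongrightarrow> semicircle_moment (l1 + l2)" by simp
  have "gen_moment_matrix \<rho> \<alpha> T N $$ (l1, l2) =
       x N * \<rho> ^ (l1 + l2) * real N powr (1 + real (l1 + l2) * (1 / 2 - \<alpha>))" if N: "N > 0" for N
  proof -
    have "sqrt (real N) / real N powr \<alpha> = real N powr (1 / 2 - \<alpha>)"
      using N by (simp add: powr_diff powr_half_sqrt)
    moreover have "\<sigma> N * sqrt (real N) = \<rho> * (sqrt (real N) / real N powr \<alpha>)"
      by (simp add: \<sigma>_def)
    ultimately have "\<sigma> N * sqrt (real N) = \<rho> * real N powr (1 / 2 - \<alpha>)" by simp
    then have s: "(\<sigma> N * sqrt (real N)) ^ (l1 + l2) = \<rho> ^ (l1 + l2) * real N powr (real (l1 + l2) * (1 / 2 - \<alpha>))"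
      using N by (simp only: power_mult_distrib) (simp add: powr_power mult.commute)
    have "gen_moment_matrix \<rho> \<alpha> T N $$ (l1, l2) = moment N (\<sigma> N) (\<lambda>_ _. 1) (l1 + l2) []"
      unfolding \<sigma>_def by (rule gen_moment_matrix_entry[OF assms(2,3)])
    also have "\<dots> = x N * (real N * (\<sigma> N * sqrt (real N)) ^ (l1 + l2))"
      using N \<sigma>[OF N] by (simp add: x_def norm_moment_def)
    also have "\<dots> = x N * \<rho> ^ (l1 + l2) * real N powr (1 + real (l1 + l2) * (1 / 2 - \<alpha>))"
      unfolding s using N by (simp add: powr_add)
    finally show ?thesis .
  qed
  with lim show ?thesis by (rule that)
qed

text \<open>The extreme eigenvalues scale with the matrix, so division by \<open>g\<close> reduces
  to entrywise convergence; in the ratio \<open>g\<close> cancels, and the denominator is the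
  trace.\<close>

lemma eigenvalue_limits:
  assumes n: "n > 0" and B: "\<And>N. B N \<in> carrier_mat n n" "\<And>N. transpose_mat (B N) = B N"
    and A: "A \<in> carrier_mat n n" "transpose_mat A = A"
    and g: "\<And>N. N > 0 \<Longrightarrow> g N > 0"
    and lim: "\<And>i j. i < n \<Longrightarrow> j < n \<Longrightarrow> (\<lambda>N. B N $$ (i, j) / g N) \<longlonglongrightarrow> A $$ (i, j)"
  shows "(\<lambda>N. lambda_max (B N) / g N) \<longlonglongrightarrow> lambda_max A"
    and "(\<lambda>N. lambda_min (B N) / g N) \<longlonglongrightarrow> lambda_min A"
    and "mat_trace A \<noteq> 0 \<Longrightarrow> (\<lambda>N. lambda_max (B N) / eig_sum (B N)) \<longlonglongrightarrow> lambda_max A / mat_trace A"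
proof -
  define F where "F N = (1 / g N) \<cdot>\<^sub>m B N" for N
  have F: "F N \<in> carrier_mat n n" "transpose_mat (F N) = F N" for N
    using B[of N] by (auto simp: F_def transpose_smult_mat)
  have "F N $$ (i, j) = B N $$ (i, j) / g N" if "i < n" "j < n" for i j N
    using B(1)[of N] that by (auto simp: F_def)
  with lim have limF: "(\<lambda>N. F N $$ (i, j)) \<longlonglongrightarrow> A $$ (i, j)" if "i < n" "j < n" for i j
    using that by simp
  have "eventually (\<lambda>N. lambda_max (F N) = lambda_max (B N) / g N) sequentially"
    using eventually_gt_at_top[of 0]
  proof eventually_elim
    case (elim N)
    then show ?case using lambda_max_smult[OF B n, of "1 / g N" N] g[of N] by (simp add: F_def)
  qed
  with tendsto_lambda_max[OF n F A limF]
  show mx: "(\<lambda>N. lambda_max (B N) / g N) \<longlonglongrightarrow> lambda_max A"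
    by (rule Lim_transform_eventually)
  have "eventually (\<lambda>N. lambda_min (F N) = lambda_min (B N) / g N) sequentially"
    using eventually_gt_at_top[of 0]
  proof eventually_elim
    case (elim N)
    then show ?case using lambda_min_smult[OF B n, of "1 / g N" N] g[of N] by (simp add: F_def)
  qed
  with tendsto_lambda_min[OF n F A limF]
  show "(\<lambda>N. lambda_min (B N) / g N) \<longlonglongrightarrow> lambda_min A"
    by (rule Lim_transform_eventually)
  assume tr: "mat_trace A \<noteq> 0"
  have dim: "dim_row A = n" "\<And>N. dim_row (B N) = n" using A(1) B(1) by auto
  have "(\<lambda>N. \<Sum>i<n. B N $$ (i, i) / g N) \<longlonglongrightarrow> mat_trace A"
    unfolding mat_trace_def dim by (intro tendsto_sum lim) auto
  also have "(\<lambda>N. \<Sum>i<n. B N $$ (i, i) / g N) = (\<lambda>N. eig_sum (B N) / g N)"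
    unfolding eig_sum_eq_trace[OF B] mat_trace_def dim sum_divide_distrib ..
  finally have "(\<lambda>N. (lambda_max (B N) / g N) / (eig_sum (B N) / g N)) \<longlonglongrightarrow> lambda_max A / mat_trace A"
    by (intro tendsto_divide mx tr)
  moreover have "eventually (\<lambda>N. (lambda_max (B N) / g N) / (eig_sum (B N) / g N) = lambda_max (B N) / eig_sum (B N)) sequentially"
    using eventually_gt_at_top[of 0]
  proof eventually_elim
    case (elim N)
    then have "g N \<noteq> 0" using g[of N] by simp
    then show ?case by simp
  qed
  ultimately show "(\<lambda>N. lambda_max (B N) / eig_sum (B N)) \<longlonglongrightarrow> lambda_max A / mat_trace A"
    by (rule Lim_transform_eventually)
qed

text \<open>Limit of the rescaled moment matrix away from the critical exponent: one entry
  dominates, the last diagonal one for \<alpha> < 1/2 and the first one for \<alpha> > 1/2.\<close>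

definition unit_diag :: "nat \<Rightarrow> nat \<Rightarrow> real mat" where
  "unit_diag n k = mat n n (\<lambda>(i, j). if i = k \<and> j = k then 1 else 0)"

lemma unit_diag_spectrum:
  assumes k: "k < n"
  shows "unit_diag n k \<in> carrier_mat n n" "transpose_mat (unit_diag n k) = unit_diag n k"
    "lambda_max (unit_diag n k) = 1" "mat_trace (unit_diag n k) = 1"
proof -
  let ?E = "unit_diag n k"
  show E: "?E \<in> carrier_mat n n" by (simp add: unit_diag_def)
  show sym: "transpose_mat ?E = ?E" by (rule eq_matI) (auto simp: unit_diag_def)
  have "mat_trace ?E = (\<Sum>i<n. if i = k then 1 else 0)"
    unfolding mat_trace_def by (intro sum.cong) (auto simp: unit_diag_def)
  then show "mat_trace ?E = 1" using k by simp
  have n: "n > 0" using k by simp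
  have row: "(\<Sum>j<n. ?E $$ (i, j) * x j) = (if i = k then x k else 0)" if "i < n" for i x
  proof -
    have "(\<Sum>j<n. ?E $$ (i, j) * x j) = (\<Sum>j<n. if j = k then if i = k then x k else 0 else 0)"
      using that by (intro sum.cong) (auto simp: unit_diag_def)
    then show ?thesis using k by simp
  qed
  obtain x where x: "\<exists>i<n. x i \<noteq> 0" "\<forall>i<n. (\<Sum>j<n. ?E $$ (i, j) * x j) = lambda_max ?E * x i"
    using lambda_max_rayleigh(1)[OF E n sym] eigenvalue_iff_fun[OF E] by blast
  \<comment> \<open>Reading the eigenvalue equation at a coordinate where the eigenvector is nonzero
    leaves 0 or 1; the k-th basis vector as test vector then excludes 0.\<close>
  have le: "lambda_max ?E \<in> {0, 1}"
  proof -
    from x(1) obtain i where i: "i < n" "x i \<noteq> 0" by blast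
    have "(if i = k then x k else 0) = lambda_max ?E * x i" using x(2) row i by metis
    then show ?thesis using i(2) by (cases "i = k") simp_all
  qed
  define y :: "nat \<Rightarrow> real" where "y i = (if i = k then 1 else 0)" for i
  have "quad_form n (\<lambda>i j. ?E $$ (i, j)) y = (\<Sum>i<n. y i * (\<Sum>j<n. ?E $$ (i, j) * y j))"
    by (simp add: quad_form_def sum_distrib_left mult_ac)
  also have "\<dots> = (\<Sum>i<n. if i = k then 1 else 0)"
    by (intro sum.cong refl) (auto simp: row y_def)
  also have "\<dots> = 1" using k by simp
  finally have "1 \<le> lambda_max ?E * (\<Sum>i<n. (y i)\<^sup>2)"
    using lambda_max_rayleigh(2)[OF E n sym, of y] by simp
  also have "(\<Sum>i<n. (y i)\<^sup>2) = (\<Sum>i<n. if i = k then 1 else 0)"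
    by (intro sum.cong refl) (simp add: y_def)
  also have "\<dots> = 1" using k by simp
  finally show "lambda_max ?E = 1" using le by auto
qed

lemma powr_ratio_tendsto:
  assumes "x \<longlonglongrightarrow> c" "e < 0"
  shows "(\<lambda>N. x N * real N powr e) \<longlonglongrightarrow> 0"
proof -
  have "(\<lambda>N. real N powr e) \<longlonglongrightarrow> 0"
    using tendsto_neg_powr[OF assms(2) filterlim_real_sequentially] .
  from tendsto_mult[OF assms(1) this] show ?thesis by simp
qed

theorem mainTheorem8:
  fixes T :: nat and \<rho> \<alpha> :: real
  assumes "T \<ge> 1" and "\<rho> > 0"
  shows
    "(\<alpha> = 1/2 \<longrightarrow>
        ((\<lambda>N. lambda_max (gen_moment_matrix \<rho> \<alpha> T N) / real N)
            \<longlonglongrightarrow> lambda_max (A_sc \<rho> T)) \<and>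
        ((\<lambda>N. lambda_min (gen_moment_matrix \<rho> \<alpha> T N) / real N)
            \<longlonglongrightarrow> lambda_min (A_sc \<rho> T)) \<and>
        ((\<lambda>N. lambda_max (gen_moment_matrix \<rho> \<alpha> T N) / eig_sum (gen_moment_matrix \<rho> \<alpha> T N))
            \<longlonglongrightarrow> lambda_max (A_sc \<rho> T) / mat_trace (A_sc \<rho> T))) \<and>
     (\<alpha> < 1/2 \<longrightarrow>
        ((\<lambda>N. lambda_max (gen_moment_matrix \<rho> \<alpha> T N) /
               (\<rho> ^ (2 * T) / (real T + 1) * real ((2 * T) choose T)
                 * real N powr (1 + 2 * real T * (1/2 - \<alpha>))))
            \<longlonglongrightarrow> 1) \<and>
        ((\<lambda>N. lambda_max (gen_moment_matrix \<rho> \<alpha> T N) / eig_sum (gen_moment_matrix \<rho> \<alpha> T N))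
            \<longlonglongrightarrow> 1)) \<and>
     (\<alpha> > 1/2 \<longrightarrow>
        ((\<lambda>N. lambda_max (gen_moment_matrix \<rho> \<alpha> T N) / real N) \<longlonglongrightarrow> 1) \<and>
        ((\<lambda>N. lambda_max (gen_moment_matrix \<rho> \<alpha> T N) / eig_sum (gen_moment_matrix \<rho> \<alpha> T N))
            \<longlonglongrightarrow> 1))"
proof -
  let ?B = "gen_moment_matrix \<rho> \<alpha> T"
  note B = gen_moment_matrix_carrier[of \<rho> \<alpha> T] gen_moment_matrix_symmetric[of \<rho> \<alpha> T]
  have T: "T + 1 > 0" by simp
  have sc0: "semicircle_moment 0 = 1" by (simp add: semicircle_moment_def catalan_def)
  have sc_nonneg: "semicircle_moment m \<ge> 0" for m by (simp add: semicircle_moment_def catalan_def)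
  have critical: "((\<lambda>N. lambda_max (?B N) / real N) \<longlonglongrightarrow> lambda_max (A_sc \<rho> T)) \<and>
        ((\<lambda>N. lambda_min (?B N) / real N) \<longlonglongrightarrow> lambda_min (A_sc \<rho> T)) \<and>
        ((\<lambda>N. lambda_max (?B N) / eig_sum (?B N)) \<longlonglongrightarrow> lambda_max (A_sc \<rho> T) / mat_trace (A_sc \<rho> T))"
    if \<alpha>: "\<alpha> = 1/2"
  proof -
    have "(\<lambda>N. ?B N $$ (i, j) / real N) \<longlonglongrightarrow> A_sc \<rho> T $$ (i, j)" if ij: "i < T + 1" "j < T + 1" for i j
    proof -
      have ij': "i \<le> T" "j \<le> T" using ij by auto
      obtain x where x: "x \<longlonglongrightarrow> semicircle_moment (i + j)"
        "\<And>N. N > 0 \<Longrightarrow> ?B N $$ (i, j) = x N * \<rho> ^ (i + j) * real N powr (1 + real (i + j) * (1 / 2 - \<alpha>))"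
        using gen_moment_matrix_entry_asymp[OF assms(2) ij', of \<alpha>] by metis
      have "(\<lambda>N. x N * \<rho> ^ (i + j)) \<longlonglongrightarrow> semicircle_moment (i + j) * \<rho> ^ (i + j)"
        by (intro tendsto_intros x)
      moreover have "eventually (\<lambda>N. x N * \<rho> ^ (i + j) = ?B N $$ (i, j) / real N) sequentially"
        using eventually_gt_at_top[of 0]
      proof eventually_elim
        case (elim N)
        then show ?case using x(2)[of N] by (simp add: \<alpha>)
      qed
      ultimately have "(\<lambda>N. ?B N $$ (i, j) / real N) \<longlonglongrightarrow> semicircle_moment (i + j) * \<rho> ^ (i + j)"
        by (rule Lim_transform_eventually)
      then show ?thesis by (simp add: A_sc_entry[OF ij'] mult.commute)
    qed
    note lims = eigenvalue_limits[OF T B A_sc_carrier A_sc_symmetric, where g = real, OF _ this]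
    have "mat_trace (A_sc \<rho> T) = (\<Sum>i<T + 1. \<rho> ^ (i + i) * semicircle_moment (i + i))"
      unfolding mat_trace_def using A_sc_carrier[of \<rho> T] by (intro sum.cong) (auto simp: A_sc_entry)
    \<comment> \<open>The diagonal entries are nonnegative and the one at index 0 is 1, so the trace
      is positive.\<close>
    also have "\<dots> \<ge> \<rho> ^ (0 + 0) * semicircle_moment (0 + 0)"
      using assms(2) sc_nonneg by (intro member_le_sum) auto
    finally have "mat_trace (A_sc \<rho> T) \<noteq> 0" using sc0 by simp
    with lims show ?thesis by simp
  qed
  have subcritical: "((\<lambda>N. lambda_max (?B N) / (\<rho> ^ (2 * T) / (real T + 1) * real ((2 * T) choose T)
                 * real N powr (1 + 2 * real T * (1/2 - \<alpha>)))) \<longlonglongrightarrow> 1) \<and>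
        ((\<lambda>N. lambda_max (?B N) / eig_sum (?B N)) \<longlonglongrightarrow> 1)" if \<alpha>: "\<alpha> < 1/2"
  proof -
    \<comment> \<open>The limiting coefficient of the entry (T, T), which dominates here: \<rho>^(2
      T) times the T-th Catalan number.\<close>
    define c where "c = \<rho> ^ (2 * T) / (real T + 1) * real ((2 * T) choose T)"
    have c: "c > 0" using assms(2) by (simp add: c_def)
    define g where "g N = c * real N powr (1 + 2 * real T * (1/2 - \<alpha>))" for N
    have g: "g N > 0" if "N > 0" for N using that c by (simp add: g_def)
    have ET: "T < T + 1" by simp
    note E = unit_diag_spectrum[OF ET]
    have "(\<lambda>N. ?B N $$ (i, j) / g N) \<longlonglongrightarrow> unit_diag (T + 1) T $$ (i, j)" if ij: "i < T + 1" "j < T + 1" for i j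
    proof -
      have ij': "i \<le> T" "j \<le> T" using ij by auto
      obtain x where x: "x \<longlonglongrightarrow> semicircle_moment (i + j)"
        "\<And>N. N > 0 \<Longrightarrow> ?B N $$ (i, j) = x N * \<rho> ^ (i + j) * real N powr (1 + real (i + j) * (1 / 2 - \<alpha>))"
        using gen_moment_matrix_entry_asymp[OF assms(2) ij', of \<alpha>] by metis
      \<comment> \<open>Exponent of N in the entry (i, j) relative to (T, T): zero there and
        negative elsewhere.\<close>
      define e where "e = (real (i + j) - 2 * real T) * (1 / 2 - \<alpha>)"
      define y where "y N = x N * (\<rho> ^ (i + j) / c)" for N
      have y: "y \<longlonglongrightarrow> semicircle_moment (i + j) * (\<rho> ^ (i + j) / c)"
        unfolding y_def by (intro tendsto_intros x) (use c in simp)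
      have ev: "eventually (\<lambda>N. y N * real N powr e = ?B N $$ (i, j) / g N) sequentially"
        using eventually_gt_at_top[of 0]
      proof eventually_elim
        case (elim N)
        have "1 + real (i + j) * (1 / 2 - \<alpha>) = e + (1 + 2 * real T * (1/2 - \<alpha>))"
          by (simp add: e_def algebra_simps)
        then have "real N powr (1 + real (i + j) * (1 / 2 - \<alpha>)) = real N powr e * real N powr (1 + 2 * real T * (1/2 - \<alpha>))"
          by (simp only: powr_add)
        then show ?case using elim x(2)[OF elim] by (simp add: g_def y_def)
      qed
      show ?thesis
      proof (cases "i = T \<and> j = T")
        case True
        then have e: "e = 0" by (simp add: e_def)
        have "c = semicircle_moment (i + j) * \<rho> ^ (i + j)"
          using True by (simp add: semicircle_moment_def c_def catalan_def mult_2)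
        then have "semicircle_moment (i + j) * (\<rho> ^ (i + j) / c) = c / c"
          by (simp only: times_divide_eq_right)
        also have "\<dots> = 1" using c by (intro divide_self) simp
        finally have "y \<longlonglongrightarrow> 1" using y by (simp only:)
        moreover have "eventually (\<lambda>N. y N = y N * real N powr e) sequentially"
          using eventually_gt_at_top[of 0] by eventually_elim (simp add: e)
        ultimately have "(\<lambda>N. y N * real N powr e) \<longlonglongrightarrow> 1"
          by (rule Lim_transform_eventually)
        from Lim_transform_eventually[OF this ev] show ?thesis
          using True by (simp add: unit_diag_def)
      next
        case False
        then have "real (i + j) < 2 * real T" using ij' by auto
        then have "e < 0" using \<alpha> by (simp add: e_def mult_neg_pos)
        from Lim_transform_eventually[OF powr_ratio_tendsto[OF y this] ev] show ?thesis
          using False ij by (auto simp: unit_diag_def)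
      qed
    qed
    note lims = eigenvalue_limits[OF T B E(1,2), where g = g, OF g this, unfolded E(3,4) g_def c_def]
    from lims(1,3) show ?thesis by simp
  qed
  have supercritical: "((\<lambda>N. lambda_max (?B N) / real N) \<longlonglongrightarrow> 1) \<and>
        ((\<lambda>N. lambda_max (?B N) / eig_sum (?B N)) \<longlonglongrightarrow> 1)" if \<alpha>: "\<alpha> > 1/2"
  proof -
    note E = unit_diag_spectrum[OF T]
    have "(\<lambda>N. ?B N $$ (i, j) / real N) \<longlonglongrightarrow> unit_diag (T + 1) 0 $$ (i, j)" if ij: "i < T + 1" "j < T + 1" for i j
    proof -
      have ij': "i \<le> T" "j \<le> T" using ij by auto
      obtain x where x: "x \<longlonglongrightarrow> semicircle_moment (i + j)"
        "\<And>N. N > 0 \<Longrightarrow> ?B N $$ (i, j) = x N * \<rho> ^ (i + j) * real N powr (1 + real (i + j) * (1 / 2 - \<alpha>))"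
        using gen_moment_matrix_entry_asymp[OF assms(2) ij', of \<alpha>] by metis
      \<comment> \<open>As 1/2 - \<alpha> is negative, longer walks are damped, and only the entry
        (0, 0), equal to N, survives the division by N.\<close>
      define e where "e = real (i + j) * (1 / 2 - \<alpha>)"
      have y: "(\<lambda>N. x N * \<rho> ^ (i + j)) \<longlonglongrightarrow> semicircle_moment (i + j) * \<rho> ^ (i + j)"
        by (intro tendsto_intros x)
      have ev: "eventually (\<lambda>N. x N * \<rho> ^ (i + j) * real N powr e = ?B N $$ (i, j) / real N) sequentially"
        using eventually_gt_at_top[of 0]
      proof eventually_elim
        case (elim N)
        then show ?case using x(2)[OF elim] by (simp add: e_def powr_add)
      qed
      show ?thesis
      proof (cases "i = 0 \<and> j = 0")
        case True
        have "eventually (\<lambda>N. x N * \<rho> ^ (i + j) = x N * \<rho> ^ (i + j) * real N powr e) sequentially"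
          using eventually_gt_at_top[of 0] by eventually_elim (use True in \<open>simp add: e_def\<close>)
        from Lim_transform_eventually[OF Lim_transform_eventually[OF y this] ev] show ?thesis
          using True sc0 by (simp add: unit_diag_def)
      next
        case False
        then have "e < 0" using \<alpha> by (auto simp: e_def mult_pos_neg)
        from Lim_transform_eventually[OF powr_ratio_tendsto[OF y this] ev] show ?thesis
          using False ij by (auto simp: unit_diag_def)
      qed
    qed
    note lims = eigenvalue_limits[OF T B E(1,2), where g = real, OF _ this, unfolded E(3,4)]
    from lims(1,3) show ?thesis by simp
  qed
  show ?thesis using critical subcritical supercritical by blast
qed

end
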